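(* Fix $d\ge2$ and $M>0$. There is a constant $c>0$ depending only on $d$ and $M$ such that for all sufficiently large $n$ the following holds. Let $H$ be any Hermitian operator on $(\mathbb C^d)^{\otimes n}$ whose spectrum has non-degenerate gaps (no translation invariance or locality is assumed), and let $A$ be any operator (not necessarily Hermitian, not necessarily local) with $\|A\|\le M$. Define $$A^\infty_\psi:=\lim_{\tau\to\infty}\frac1\tau\int_0^\tau\langle\psi|A(t)|\psi\rangle\,dt,\qquad \Delta A^\infty_\psi:=\lim_{\tau\to\infty}\frac1\tau\int_0^\tau\big|\langle\psi|A(t)|\psi\rangle-A^\infty_\psi\big|^2dt,$$ with $A(t)=e^{iHt}Ae^{-iHt}$. Then $$\Pr_{\psi\in P}\big(\Delta A^\infty_\psi\le e^{-cn}\big)\ge 1-e^{-cn}.$$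
   Context: The spectrum $\{E_j\}$ of a Hamiltonian has non-degenerate gaps if for all $j\neq k$, $E_j-E_k=E_{j'}-E_{k'}$ implies $j=j'$ and $k=k'$. A random product state is $|\psi\rangle=\bigotimes_{l=1}^n|\psi_l\rangle$ where each $|\psi_l\rangle\in\mathbb C^d$ is chosen independently and Haar-uniformly at random; $\Pr_{\psi\in P}$ denotes probability over this distribution. $\|\cdot\|$ is the operator norm. *)

theory Defs
  imports "HOL-Probability.Probability" "Jordan_Normal_Form.Schur_Decomposition"
    "Jordan_Normal_Form.Char_Poly"
begin

text \<open>Operators on (C^d)^{\<otimes> n} are complex (d^n)x(d^n) matrices (JNF). The basis index
  k < d^n corresponds to the digit string (k div d^l mod d)_{l<n}.\<close>

definition hermitian_mat :: "nat \<Rightarrow> complex mat \<Rightarrow> bool" where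
  "hermitian_mat D H \<longleftrightarrow> H \<in> carrier_mat D D \<and> (\<forall>i<D. \<forall>j<D. H $$ (i,j) = cnj (H $$ (j,i)))"

definition unitary_mat :: "nat \<Rightarrow> complex mat \<Rightarrow> bool" where
  "unitary_mat D U \<longleftrightarrow> U \<in> carrier_mat D D \<and> U * mat_adjoint U = 1\<^sub>m D"

definition mat_exp :: "complex mat \<Rightarrow> complex mat" where
  "mat_exp X = mat (dim_row X) (dim_col X) (\<lambda>(i,j). \<Sum>k. (X ^\<^sub>m k) $$ (i,j) / of_nat (fact k))"

definition nondeg_gaps :: "complex list \<Rightarrow> bool" where
  "nondeg_gaps E \<longleftrightarrow> (\<forall>j<length E. \<forall>k<length E. \<forall>j'<length E. \<forall>k'<length E.
     j \<noteq> k \<longrightarrow> E ! j - E ! k = E ! j' - E ! k' \<longrightarrow> j = j' \<and> k = k')"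

definition spectrum_nondeg_gaps :: "complex mat \<Rightarrow> bool" where
  "spectrum_nondeg_gaps H \<longleftrightarrow>
     (\<exists>E. char_poly H = (\<Prod>a\<leftarrow>E. [:- a, 1:]) \<and> nondeg_gaps E)"

definition vnorm :: "complex vec \<Rightarrow> real" where
  "vnorm v = sqrt (\<Sum>i<dim_vec v. (cmod (v $ i))\<^sup>2)"

definition op_norm :: "nat \<Rightarrow> complex mat \<Rightarrow> real" where
  "op_norm D A = Sup {vnorm (A *\<^sub>v v) | v. v \<in> carrier_vec D \<and> vnorm v \<le> 1}"

definition expect :: "complex mat \<Rightarrow> complex vec \<Rightarrow> complex" where
  "expect B \<psi> = (\<Sum>i<dim_vec \<psi>. cnj (\<psi> $ i) * (B *\<^sub>v \<psi>) $ i)"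

definition heis :: "complex mat \<Rightarrow> complex mat \<Rightarrow> real \<Rightarrow> complex mat" where
  "heis H A t = mat_exp ((\<i> * of_real t) \<cdot>\<^sub>m H) * A * mat_exp ((- \<i> * of_real t) \<cdot>\<^sub>m H)"

definition time_avg :: "(real \<Rightarrow> complex) \<Rightarrow> complex" where
  "time_avg f = Lim at_top (\<lambda>\<tau>. integral {0..\<tau>} f / of_real \<tau>)"

definition time_avg_real :: "(real \<Rightarrow> real) \<Rightarrow> real" where
  "time_avg_real f = Lim at_top (\<lambda>\<tau>. integral {0..\<tau>} f / \<tau>)"

definition A_inf :: "complex mat \<Rightarrow> complex mat \<Rightarrow> complex vec \<Rightarrow> complex" where
  "A_inf H A \<psi> = time_avg (\<lambda>t. expect (heis H A t) \<psi>)"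

definition DeltaA_inf :: "complex mat \<Rightarrow> complex mat \<Rightarrow> complex vec \<Rightarrow> real" where
  "DeltaA_inf H A \<psi> = time_avg_real (\<lambda>t. (cmod (expect (heis H A t) \<psi> - A_inf H A \<psi>))\<^sup>2)"

definition product_state :: "nat \<Rightarrow> nat \<Rightarrow> (nat \<Rightarrow> nat \<Rightarrow> complex) \<Rightarrow> complex vec" where
  "product_state d n \<phi> = vec (d ^ n) (\<lambda>k. \<Prod>l<n. \<phi> l ((k div d ^ l) mod d))"

definition Cd_space :: "nat \<Rightarrow> (nat \<Rightarrow> complex) measure" where
  "Cd_space d = PiM {0..<d} (\<lambda>_. borel)"

definition haar_sphere :: "nat \<Rightarrow> (nat \<Rightarrow> complex) measure \<Rightarrow> bool" where
  "haar_sphere d \<mu> \<longleftrightarrow> prob_space \<mu> \<and> sets \<mu> = sets (Cd_space d) \<and>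
     (AE \<phi> in \<mu>. (\<Sum>i<d. (cmod (\<phi> i))\<^sup>2) = 1) \<and>
     (\<forall>U. unitary_mat d U \<longrightarrow>
        distr \<mu> \<mu> (\<lambda>\<phi>. restrict (\<lambda>i. \<Sum>j<d. U $$ (i,j) * \<phi> j) {0..<d}) = \<mu>)"

definition product_measure :: "nat \<Rightarrow> (nat \<Rightarrow> complex) measure \<Rightarrow> (nat \<Rightarrow> nat \<Rightarrow> complex) measure" where
  "product_measure n \<mu> = PiM {0..<n} (\<lambda>_. \<mu>)"

end

(* Only the pairs of distinct levels survive the time average, which gives
   Delta A = sum_{i <> j} |c_i|^2 |c_j|^2 |A_ij|^2 with c_i the amplitude of psi on the i-th energy
   eigenvector.  By AM-GM and the bound M^2 on the rows and columns of (|A_ij|^2), this is at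
   most M^2 sum_i |c_i|^4.  For one Haar-random site E|<v,phi>|^4 = 2 |v|^4 / (d (d + 1)), and
   by Cauchy-Schwarz this moment bound tensorises to arbitrary, possibly entangled, vectors v;
   hence E sum_i |c_i|^4 <= d^n (2 / (d (d + 1)))^n = (2 / (d + 1))^n, and Markov's inequality
   finishes the proof. *)

theory Submission
  imports Defs
begin

subsection \<open>Fourth moments of a Haar-random site\<close>

text \<open>The measure \<mu> is given only by its invariance under unitaries, so every moment has
  to be extracted from a well-chosen unitary; one with a prescribed first row reduces any linear
  form to a single coordinate. The eigenvectors of H are arbitrary, so the amplitude of a product
  state on one of them does not factor over the sites. Its moment bound must therefore survive the
  contraction of one site at a time with no loss of constant, because a loss at every site would be
  exponential in n. What has to be beaten is the number d^n of levels: the surviving ratio 2 / (d +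
  1) is below 1 exactly because d >= 2. The gap condition acts twice: it makes the frequencies of
  distinct off-diagonal pairs different, and it makes the levels themselves distinct, so that
  frequency zero occurs on the diagonal only and is what subtracting the mean removes.
  \<open>Lim\<close> carries no proof of convergence, so each time average is evaluated through an
  actual limit.\<close>

lemma unitary_mat_iff:
  "unitary_mat D U \<longleftrightarrow> U \<in> carrier_mat D D \<and>
     (\<forall>i<D. \<forall>j<D. (\<Sum>k<D. U $$ (i,k) * cnj (U $$ (j,k))) = (if i = j then 1 else 0))"
proof (cases "U \<in> carrier_mat D D")
  case True
  have "(U * mat_adjoint U) $$ (i,j) = (\<Sum>k<D. U $$ (i,k) * cnj (U $$ (j,k)))"
    if "i < D" "j < D" for i j
  proof -
    have "(\<Sum>k = 0..<D. U $$ (i,k) * mat_adjoint U $$ (k,j)) = (\<Sum>k<D. U $$ (i,k) * cnj (U $$ (j,k)))"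
      using True that by (intro sum.cong) (auto simp: mat_adjoint_def mat_of_rows_def)
    moreover have "dim_col (mat_adjoint U) = D" "dim_row (mat_adjoint U) = D"
      using True by (auto simp: mat_adjoint_def)
    ultimately show ?thesis
      using True that by (simp add: scalar_prod_def)
  qed
  moreover have "dim_row (U * mat_adjoint U) = D" "dim_col (U * mat_adjoint U) = D"
    using True by (auto simp: mat_adjoint_def)
  ultimately have "U * mat_adjoint U = 1\<^sub>m D \<longleftrightarrow>
      (\<forall>i<D. \<forall>j<D. (\<Sum>k<D. U $$ (i,k) * cnj (U $$ (j,k))) = (if i = j then 1 else 0))"
    unfolding mat_eq_iff by auto
  then show ?thesis using True unfolding unitary_mat_def by blast
qed (simp add: unitary_mat_def)

text \<open>A Householder reflection; adding the phase of the first entry keeps the reflecting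
  vector away from zero.\<close>
lemma exists_unitary_mat_first_row:
  fixes u :: "nat \<Rightarrow> complex"
  assumes d: "0 < d" and u: "(\<Sum>i<d. (cmod (u i))\<^sup>2) = 1"
  shows "\<exists>U s. unitary_mat d U \<and> cmod s = 1 \<and> (\<forall>j<d. U $$ (0,j) = s * u j)"
proof -
  define s where "s = (if u 0 = 0 then 1 else cnj (u 0) / cmod (u 0))"
  have s1: "cmod s = 1" by (auto simp: s_def norm_divide)
  have ss: "s * cnj s = 1" using s1 by (simp add: complex_norm_square[symmetric])
  have su: "cnj (u 0) = s * cmod (u 0)" by (auto simp: s_def)
  have su': "u 0 = cnj s * cmod (u 0)" 
    by (metis complex_cnj_cnj complex_cnj_complex_of_real complex_cnj_mult su)
  \<comment> \<open>Row 0 of 1 - 2 w w^* / N is e_0 - (2 w_0 / N) cnj w. The phase s gives N = 2 (1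
    + |u_0|) and 2 w_0 / N = s, so the row becomes -s u; the conjugate in \<open>w\<close> is what
    makes u itself appear there.\<close>
  define w where "w i = cnj (u i) + (if i = 0 then s else 0)" for i
  define N where "N = (\<Sum>i<d. w i * cnj (w i))"
  have w0: "w 0 = s * (1 + cmod (u 0))" by (simp add: w_def su algebra_simps)
  have "N = (\<Sum>i<d. (cmod (u i))\<^sup>2 + (if i = 0 then 1 + cnj s * s * cmod (u 0) + s * cnj s * cmod (u 0) else 0))"
    unfolding N_def of_real_sum
  proof (rule sum.cong)
    fix i assume "i \<in> {..<d}"
    show "w i * cnj (w i) = ((cmod (u i))\<^sup>2) + (if i = 0 then 1 + cnj s * s * cmod (u 0) + s * cnj s * cmod (u 0) else 0)"
    proof (cases "i = 0")
      case True
      have "w 0 * cnj (w 0) = u 0 * cnj (u 0) + s * cnj s + cnj (u 0) * cnj s + s * u 0"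
        by (simp add: w_def algebra_simps)
      also have "\<dots> = (cmod (u 0))\<^sup>2 + 1 + (s * cmod (u 0)) * cnj s + s * (cnj s * cmod (u 0))"
        by (simp only: complex_norm_square ss of_real_add of_real_1 flip: su su')
      finally show ?thesis using True by (simp add: algebra_simps)
    next
      case False
      then show ?thesis unfolding w_def complex_norm_square by simp
    qed
  qed simp
  also have "\<dots> = of_real (\<Sum>i<d. (cmod (u i))\<^sup>2) + (1 + 2 * cmod (u 0))"
    using d ss by (simp add: sum.distrib mult.commute)
  finally have N: "N = 2 * (1 + cmod (u 0))" by (simp add: u)
  have N0: "N \<noteq> 0"
  proof -
    have "N = complex_of_real (2 * (1 + cmod (u 0)))" by (simp add: N)
    moreover have "2 * (1 + cmod (u 0)) > 0" by (smt (verit) norm_ge_zero)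
    ultimately show ?thesis by (metis less_irrefl of_real_eq_0_iff)
  qed
  have cN: "cnj N = N" by (simp add: N)
  define U where "U = mat d d (\<lambda>(i,j). (if i = j then 1 else 0) - 2 * w i * cnj (w j) / N)"
  have "(\<Sum>k<d. U $$ (i,k) * cnj (U $$ (j,k))) = (if i = j then 1 else 0)" if ij: "i < d" "j < d" for i j
  proof -
    have "(\<Sum>k<d. U $$ (i,k) * cnj (U $$ (j,k))) =
      (\<Sum>k<d. (if k = i then (if i = j then 1 else 0) else 0)
          - (if k = i then 2 * w i * cnj (w j) / N else 0)
          - (if k = j then 2 * w i * cnj (w j) / N else 0)
          + (4 * w i * cnj (w j) / N\<^sup>2) * (w k * cnj (w k)))"
      using ij cN N0 by (intro sum.cong) (auto simp: U_def field_simps power2_eq_square)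
    also have "\<dots> = (if i = j then 1 else 0) - 4 * w i * cnj (w j) / N + (4 * w i * cnj (w j) / N\<^sup>2) * N"
      using ij unfolding N_def by (simp add: sum.distrib sum_subtractf sum_distrib_left)
    also have "\<dots> = (if i = j then 1 else 0)" using N0 by (simp add: power2_eq_square)
    finally show ?thesis .
  qed
  then have "unitary_mat d U" by (simp add: unitary_mat_iff U_def)
  moreover have "U $$ (0,j) = (- s) * u j" if "j < d" for j
  proof -
    have "U $$ (0,j) = (if j = 0 then 1 else 0) - 2 * w 0 / N * cnj (w j)"
      using that d by (simp add: U_def)
    also have "2 * w 0 / N = s"
    proof -
      have "2 * w 0 = s * N" by (simp add: w0 N algebra_simps)
      then show ?thesis using N0 by simp
    qed
    finally have "U $$ (0,j) = (if j = 0 then 1 else 0) - s * cnj (w j)" .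
    then show ?thesis using ss by (cases "j = 0") (simp_all add: w_def ring_distribs)
  qed
  moreover have "cmod (- s) = 1" by (simp add: s1)
  ultimately show ?thesis by blast
qed

lemma borel_measurable_haar_coord:
  assumes "haar_sphere d \<mu>" "i < d"
  shows "(\<lambda>\<phi>. \<phi> i) \<in> borel_measurable \<mu>"
proof -
  have s: "sets \<mu> = sets (PiM {0..<d} (\<lambda>_. borel))"
    using assms by (simp add: haar_sphere_def Cd_space_def)
  have "(\<lambda>\<phi>. \<phi> i) \<in> borel_measurable (PiM {0..<d} (\<lambda>_. borel :: complex measure))"
    using assms by (intro measurable_component_singleton) simp
  then show ?thesis by (simp add: measurable_cong_sets[OF s refl])
qed

lemma borel_measurable_haar_linear:
  assumes "haar_sphere d \<mu>"
  shows "(\<lambda>\<phi>. \<Sum>i<d. v i * \<phi> i) \<in> borel_measurable \<mu>"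
  by (intro borel_measurable_sum borel_measurable_times borel_measurable_const
      borel_measurable_haar_coord[OF assms]) simp

lemma haar_AE_coord_le_1:
  assumes "haar_sphere d \<mu>"
  shows "AE \<phi> in \<mu>. \<forall>i<d. cmod (\<phi> i) \<le> 1"
proof -
  have "AE \<phi> in \<mu>. (\<Sum>i<d. (cmod (\<phi> i))\<^sup>2) = 1"
    using assms by (simp add: haar_sphere_def)
  then show ?thesis
  proof eventually_elim
    case (elim \<phi>)
    have "(cmod (\<phi> i))\<^sup>2 \<le> 1" if "i < d" for i
      using member_le_sum[of i "{..<d}" "\<lambda>i. (cmod (\<phi> i))\<^sup>2"] that elim by simp
    then show ?case by (simp add: power_le_one_iff)
  qed
qed

lemma integrable_haar_linear_power:
  assumes h: "haar_sphere d \<mu>"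
  shows "integrable \<mu> (\<lambda>\<phi>. cmod (\<Sum>i<d. v i * \<phi> i) ^ m)"
proof -
  interpret prob_space \<mu> using h by (simp add: haar_sphere_def)
  show ?thesis
  proof (rule integrable_const_bound)
    show "AE \<phi> in \<mu>. norm (cmod (\<Sum>i<d. v i * \<phi> i) ^ m) \<le> (\<Sum>i<d. cmod (v i)) ^ m"
      using haar_AE_coord_le_1[OF h]
    proof eventually_elim
      case (elim \<phi>)
      have "cmod (\<Sum>i<d. v i * \<phi> i) \<le> (\<Sum>i<d. cmod (v i))"
        using elim by (intro sum_norm_le) (auto simp: norm_mult intro!: mult_left_le)
      then show ?case by (simp add: power_mono)
    qed
    show "(\<lambda>\<phi>. cmod (\<Sum>i<d. v i * \<phi> i) ^ m) \<in> borel_measurable \<mu>"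
      by (intro borel_measurable_power measurable_compose[OF _ borel_measurable_norm]
        borel_measurable_haar_linear[OF h])
  qed
qed

text \<open>After normalisation the coefficients form, up to a phase, the first row of a unitary.
  Invariance of \<mu> then identifies the law of the linear form with that of the coordinate 0, and
  the phase disappears in the modulus.\<close>

lemma haar_linear_moment:
  assumes h: "haar_sphere d \<mu>" and d: "0 < d"
  shows "(\<integral>\<phi>. cmod (\<Sum>i<d. v i * \<phi> i) ^ 4 \<partial>\<mu>)
       = (\<integral>\<phi>. cmod (\<phi> 0) ^ 4 \<partial>\<mu>) * (\<Sum>i<d. (cmod (v i))\<^sup>2)\<^sup>2"
proof -
  define r where "r = sqrt (\<Sum>i<d. (cmod (v i))\<^sup>2)"
  have r2: "r\<^sup>2 = (\<Sum>i<d. (cmod (v i))\<^sup>2)" by (simp add: r_def sum_nonneg)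
  show ?thesis
  proof (cases "r = 0")
    case True
    then have "\<forall>i<d. v i = 0" using r2 by (simp add: sum_nonneg_eq_0_iff)
    then show ?thesis using True r2 by simp
  next
    case False
    define u where "u i = v i / r" for i
    have "(\<Sum>i<d. (cmod (u i))\<^sup>2) = r\<^sup>2 / r\<^sup>2"
      unfolding u_def norm_divide power_divide r2 norm_of_real power2_abs by (simp only: sum_divide_distrib)
    then have "(\<Sum>i<d. (cmod (u i))\<^sup>2) = 1" using False by simp
    from exists_unitary_mat_first_row[OF d this] obtain U s where
      U: "unitary_mat d U" and s: "cmod s = 1" and row: "\<And>j. j < d \<Longrightarrow> U $$ (0,j) = s * u j"
      by blast
    let ?T = "\<lambda>\<phi>. restrict (\<lambda>i. \<Sum>j<d. U $$ (i,j) * \<phi> j) {0..<d}"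
    have sets: "sets \<mu> = sets (PiM {0..<d} (\<lambda>_. borel))"
      using h by (simp add: haar_sphere_def Cd_space_def)
    have "?T \<in> measurable \<mu> (PiM {0..<d} (\<lambda>_. borel))"
      by (intro measurable_restrict borel_measurable_haar_linear[OF h])
    then have T: "?T \<in> measurable \<mu> \<mu>"
      by (simp add: measurable_cong_sets[OF refl sets])
    have "(\<integral>\<phi>. cmod (\<phi> 0) ^ 4 \<partial>\<mu>) = (\<integral>\<phi>. cmod (\<phi> 0) ^ 4 \<partial>(distr \<mu> \<mu> ?T))"
      using h U by (simp add: haar_sphere_def)
    also have "\<dots> = (\<integral>\<phi>. cmod (?T \<phi> 0) ^ 4 \<partial>\<mu>)"
      using T borel_measurable_haar_coord[OF h d]
      by (intro integral_distr borel_measurable_power measurable_compose[OF _ borel_measurable_norm])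
    also have "\<dots> = (\<integral>\<phi>. cmod (\<Sum>i<d. v i * \<phi> i) ^ 4 / r ^ 4 \<partial>\<mu>)"
    proof (rule Bochner_Integration.integral_cong)
      fix \<phi> assume "\<phi> \<in> space \<mu>"
      have "?T \<phi> 0 = (s / r) * (\<Sum>i<d. v i * \<phi> i)"
        using d row by (simp add: u_def sum_distrib_left mult_ac)
      moreover have "cmod (s / r) ^ 4 = 1 / r ^ 4" by (simp add: norm_divide s power_divide)
      moreover have "cmod ((s / r) * (\<Sum>i<d. v i * \<phi> i)) ^ 4 = cmod (s / r) ^ 4 * cmod (\<Sum>i<d. v i * \<phi> i) ^ 4"
        by (simp only: norm_mult power_mult_distrib)
      ultimately show "cmod (?T \<phi> 0) ^ 4 = cmod (\<Sum>i<d. v i * \<phi> i) ^ 4 / r ^ 4"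
        by simp
    qed simp
    finally show ?thesis using False by (simp add: r2[symmetric])
  qed
qed

text \<open>With x + i y = 2 a cnj b, the four squared moduli are p + x, p - x, p + y and p - y. The
  odd terms cancel on squaring, and x^2 + y^2 = 4 |a|^2 |b|^2. The signs alone would leave x^2,
  which still depends on the relative phase of a and b.\<close>

lemma cmod_fourth_power_phase_average:
  "cmod (a + b) ^ 4 + cmod (a - b) ^ 4 + cmod (a + \<i> * b) ^ 4 + cmod (a - \<i> * b) ^ 4
     = 4 * cmod a ^ 4 + 4 * cmod b ^ 4 + 16 * ((cmod a)\<^sup>2 * (cmod b)\<^sup>2)"
proof -
  define p x y where "p = (cmod a)\<^sup>2 + (cmod b)\<^sup>2"
    and "x = 2 * (Re a * Re b + Im a * Im b)" and "y = 2 * (Im a * Re b - Re a * Im b)"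
  have sq: "(cmod (a + b))\<^sup>2 = p + x" "(cmod (a - b))\<^sup>2 = p - x"
    "(cmod (a + \<i> * b))\<^sup>2 = p + y" "(cmod (a - \<i> * b))\<^sup>2 = p - y"
    unfolding p_def x_def y_def cmod_power2 by (simp_all add: power2_eq_square algebra_simps)
  have fourth: "cmod z ^ 4 = ((cmod z)\<^sup>2)\<^sup>2" for z
    by (simp flip: power_mult)
  have "cmod (a + b) ^ 4 = (p + x)\<^sup>2" "cmod (a - b) ^ 4 = (p - x)\<^sup>2"
    "cmod (a + \<i> * b) ^ 4 = (p + y)\<^sup>2" "cmod (a - \<i> * b) ^ 4 = (p - y)\<^sup>2"
    unfolding fourth sq by simp_all
  moreover have "x\<^sup>2 + y\<^sup>2 = 4 * ((cmod a)\<^sup>2 * (cmod b)\<^sup>2)"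
    unfolding x_def y_def cmod_power2 by (simp add: power2_eq_square algebra_simps)
  moreover have "(p + x)\<^sup>2 + (p - x)\<^sup>2 + (p + y)\<^sup>2 + (p - y)\<^sup>2 = 4 * p\<^sup>2 + 2 * (x\<^sup>2 + y\<^sup>2)"
    by (simp add: power2_eq_square algebra_simps)
  moreover have "p\<^sup>2 = cmod a ^ 4 + cmod b ^ 4 + 2 * ((cmod a)\<^sup>2 * (cmod b)\<^sup>2)"
    by (simp add: p_def power2_sum flip: power_mult)
  ultimately show ?thesis by simp
qed

text \<open>Averaging \<open>cmod (\<phi> i + \<zeta> * \<phi> j) ^ 4\<close> over the fourth roots of unity \<open>\<zeta>\<close> isolates the mixed
  moments; the constant then follows by integrating the square of the normalisation.\<close>
lemma haar_fourth_moment: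
  assumes h: "haar_sphere d \<mu>" and d: "2 \<le> d"
  shows "(\<integral>\<phi>. cmod (\<Sum>i<d. v i * \<phi> i) ^ 4 \<partial>\<mu>)
       = 2 / (real d * (real d + 1)) * (\<Sum>i<d. (cmod (v i))\<^sup>2)\<^sup>2"
proof -
  interpret prob_space \<mu> using h by (simp add: haar_sphere_def)
  define K where "K = (\<integral>\<phi>. cmod (\<phi> 0) ^ 4 \<partial>\<mu>)"
  have lin: "(\<integral>\<phi>. cmod (\<Sum>i<d. v i * \<phi> i) ^ 4 \<partial>\<mu>) = K * (\<Sum>i<d. (cmod (v i))\<^sup>2)\<^sup>2" for v
    unfolding K_def using d by (intro haar_linear_moment[OF h]) simp
  have coord: "(\<lambda>\<phi>. cmod (\<phi> i) ^ 4) = (\<lambda>\<phi>. cmod (\<Sum>k<d. (if k = i then 1 else 0) * \<phi> k) ^ 4)" 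
    if "i < d" for i using that by (simp add: if_distrib[of "\<lambda>x. x * _"] cong: if_cong)
  have diag: "(\<integral>\<phi>. cmod (\<phi> i) ^ 4 \<partial>\<mu>) = K" and int1: "integrable \<mu> (\<lambda>\<phi>. cmod (\<phi> i) ^ 4)" 
    if "i < d" for i
    unfolding coord[OF that] lin using that integrable_haar_linear_power[OF h]
    by (simp_all add: if_distrib[of "\<lambda>x. (cmod x)\<^sup>2"] cong: if_cong)
  have off: "integrable \<mu> (\<lambda>\<phi>. (cmod (\<phi> i))\<^sup>2 * (cmod (\<phi> j))\<^sup>2) \<and>
     (\<integral>\<phi>. (cmod (\<phi> i))\<^sup>2 * (cmod (\<phi> j))\<^sup>2 \<partial>\<mu>) = K / 2" if ij: "i < d" "j < d" "i \<noteq> j" for i j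
  proof -
    define e where "e \<zeta> k = (if k = i then 1 else if k = j then \<zeta> else 0)" for \<zeta> :: complex and k
    have e: "(\<Sum>k<d. e \<zeta> k * \<phi> k) = \<phi> i + \<zeta> * \<phi> j" for \<zeta> \<phi>
    proof -
      have "(\<Sum>k<d. e \<zeta> k * \<phi> k) = (\<Sum>k<d. (if k = i then \<phi> i else 0) + (if k = j then \<zeta> * \<phi> j else 0))"
        using ij by (intro sum.cong) (auto simp: e_def)
      then show ?thesis using ij by (simp add: sum.distrib)
    qed
    have e2: "(\<Sum>k<d. (cmod (e \<zeta> k))\<^sup>2) = 2" if "cmod \<zeta> = 1" for \<zeta>
    proof -
      have "(\<Sum>k<d. (cmod (e \<zeta> k))\<^sup>2) = (\<Sum>k<d. (if k = i then 1 else 0) + (if k = j then 1 else 0))"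
        using ij that by (intro sum.cong) (auto simp: e_def)
      then show ?thesis using ij by (simp add: sum.distrib)
    qed
    have I: "integrable \<mu> (\<lambda>\<phi>. cmod (\<phi> i + \<zeta> * \<phi> j) ^ 4)" for \<zeta>
      using integrable_haar_linear_power[OF h, of "e \<zeta>" 4] unfolding e .
    have J: "(\<integral>\<phi>. cmod (\<phi> i + \<zeta> * \<phi> j) ^ 4 \<partial>\<mu>) = 4 * K" if "cmod \<zeta> = 1" for \<zeta>
      using lin[of "e \<zeta>"] unfolding e e2[OF that] by simp
    let ?S = "\<lambda>\<phi>. (cmod (\<phi> i + 1 * \<phi> j) ^ 4 + cmod (\<phi> i + (-1) * \<phi> j) ^ 4 + cmod (\<phi> i + \<i> * \<phi> j) ^ 4
        + cmod (\<phi> i + (-\<i>) * \<phi> j) ^ 4 - 4 * cmod (\<phi> i) ^ 4 - 4 * cmod (\<phi> j) ^ 4) / 16"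
    have eq: "(\<lambda>\<phi>. (cmod (\<phi> i))\<^sup>2 * (cmod (\<phi> j))\<^sup>2) = ?S"
      using cmod_fourth_power_phase_average by (auto simp: fun_eq_iff)
    have "integrable \<mu> ?S"
      by (intro Bochner_Integration.integrable_divide_zero Bochner_Integration.integrable_diff 
         Bochner_Integration.integrable_add I integrable_mult_right int1 ij)
    \<comment> \<open>Each of the four vectors e_i + \<zeta> e_j has squared norm 2, hence moment 4
      K; the total is (16 K - 8 K) / 16 = K / 2.\<close>
    moreover have "(\<integral>\<phi>. ?S \<phi> \<partial>\<mu>) = (4 * K + 4 * K + 4 * K + 4 * K - 4 * K - 4 * K) / 16"
      by (simp only: Bochner_Integration.integral_divide_zero Bochner_Integration.integral_diff 
         Bochner_Integration.integral_add I J int1 ij Bochner_Integration.integrable_diff 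
         Bochner_Integration.integrable_add integrable_mult_right integral_mult_right_zero diag
         norm_one norm_minus_cancel norm_ii)
    ultimately show ?thesis unfolding eq by simp
  qed
  have sq: "(\<integral>\<phi>. (cmod (\<phi> i))\<^sup>2 * (cmod (\<phi> j))\<^sup>2 \<partial>\<mu>) = (if i = j then K else K / 2)"
    "integrable \<mu> (\<lambda>\<phi>. (cmod (\<phi> i))\<^sup>2 * (cmod (\<phi> j))\<^sup>2)" if "i < d" "j < d" for i j
    using off[OF that] diag[OF that(1)] int1[OF that(1)]
    by (cases "i = j"; auto simp flip: power_add)+
  have "(1 :: real) = (\<integral>\<phi>. 1 \<partial>\<mu>)" by (simp add: prob_space)
  also have "\<dots> = (\<integral>\<phi>. (\<Sum>i<d. \<Sum>j<d. (cmod (\<phi> i))\<^sup>2 * (cmod (\<phi> j))\<^sup>2) \<partial>\<mu>)"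
  proof (rule integral_cong_AE)
    have "AE \<phi> in \<mu>. (\<Sum>i<d. (cmod (\<phi> i))\<^sup>2) = 1"
      using h by (simp add: haar_sphere_def)
    then show "AE \<phi> in \<mu>. 1 = (\<Sum>i<d. \<Sum>j<d. (cmod (\<phi> i))\<^sup>2 * (cmod (\<phi> j))\<^sup>2)"
      by eventually_elim (simp add: sum_product[symmetric])
  qed (use sq in \<open>auto intro!: borel_measurable_sum\<close>)
  also have "\<dots> = (\<Sum>i<d. \<Sum>j<d. \<integral>\<phi>. (cmod (\<phi> i))\<^sup>2 * (cmod (\<phi> j))\<^sup>2 \<partial>\<mu>)"
    by (subst Bochner_Integration.integral_sum, intro Bochner_Integration.integrable_sum sq, simp_all)
      (intro sum.cong refl Bochner_Integration.integral_sum sq, simp_all)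
  \<comment> \<open>K / 2 for all d^2 pairs and another K / 2 for the d diagonal ones.\<close>
  also have "\<dots> = (\<Sum>i<d. \<Sum>j<d. K / 2 + (if i = j then K / 2 else 0))"
    using sq by (intro sum.cong) auto
  also have "\<dots> = K * (real d * (real d + 1)) / 2"
    by (simp add: sum.distrib algebra_simps)
  finally have "K * (real d * (real d + 1)) = 2" by simp
  moreover have "real d * (real d + 1) \<noteq> 0" using d by simp
  ultimately have "K = 2 / (real d * (real d + 1))" by (metis nonzero_mult_div_cancel_right)
  then show ?thesis using lin by simp
qed

subsection \<open>Fourth moments of random product states\<close>

text \<open>With D = d^n this separates the digit of site n, the most significant one, from the
  digits of the sites below it; it drives the induction on the number of sites.\<close>

lemma sum_split_last_digit:
  fixes f :: "nat \<Rightarrow> 'a::comm_monoid_add"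
  assumes "0 < D"
  shows "(\<Sum>k<D * d. f k) = (\<Sum>r<D. \<Sum>a<d. f (r + a * D))"
proof -
  have "r + a * D < D * d" if "r < D" "a < d" for r a
  proof -
    have "r + a * D < Suc a * D" using that by simp
    also have "\<dots> \<le> d * D" using that by (intro mult_right_mono) simp_all
    finally show ?thesis by (simp add: mult.commute)
  qed
  then have "(\<Sum>k<D * d. f k) = (\<Sum>(r,a)\<in>{..<D} \<times> {..<d}. f (r + a * D))"
    using assms by (intro sum.reindex_bij_witness[where i = "\<lambda>(r,a). r + a * D" and j = "\<lambda>k. (k mod D, k div D)"])
      (auto simp: less_mult_imp_div_less mult.commute div_less_iff_less_mult )
  then show ?thesis by (simp add: sum.cartesian_product)
qed

lemma digit_add_multiple:
  fixes d :: nat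
  assumes "l < n" "0 < d"
  shows "(r + a * d ^ n) div d ^ l mod d = r div d ^ l mod d"
proof -
  obtain m where n: "n = Suc (l + m)" using assms(1) less_imp_Suc_add by blast
  have "a * d ^ n = (d * (a * d ^ m)) * d ^ l"
    by (simp add: n power_add)
  then have "(r + a * d ^ n) div d ^ l = d * (a * d ^ m) + r div d ^ l"
    using div_mult_self1[of "d ^ l" r "d * (a * d ^ m)"] assms(2) by (simp only: power_eq_0_iff) simp
  then show ?thesis by simp
qed

lemma borel_measurable_product_amplitude:
  fixes \<mu> :: "(nat \<Rightarrow> complex) measure"
  assumes d: "0 < d" and meas: "\<And>i. i < d \<Longrightarrow> (\<lambda>\<phi>. \<phi> i) \<in> borel_measurable \<mu>"
  shows "(\<lambda>\<phi>. \<Sum>k\<in>S. v k * (\<Prod>l<n. \<phi> l (k div d ^ l mod d))) \<in> borel_measurable (product_measure n \<mu>)"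
  unfolding product_measure_def
proof (intro borel_measurable_sum borel_measurable_times borel_measurable_const borel_measurable_prod)
  fix k l assume "l \<in> {..<n}"
  then have "(\<lambda>\<phi>. \<phi> l) \<in> measurable (PiM {0..<n} (\<lambda>_. \<mu>)) \<mu>"
    by (intro measurable_component_singleton) simp
  from measurable_compose[OF this meas, of "k div d ^ l mod d"] d
  show "(\<lambda>\<phi>. \<phi> l (k div d ^ l mod d)) \<in> borel_measurable (PiM {0..<n} (\<lambda>_. \<mu>))" by simp
qed

text \<open>Cauchy-Schwarz with free weights. The condition on zero weights matches the convention
  that division by 0 gives 0, so that terms of weight 0 vanish on both sides.\<close>

lemma sum_square_le_weighted:
  fixes w x :: "'a \<Rightarrow> real"
  assumes "finite S" and w: "\<And>i. i \<in> S \<Longrightarrow> 0 \<le> w i" and x: "\<And>i. i \<in> S \<Longrightarrow> w i = 0 \<Longrightarrow> x i = 0"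
  shows "(\<Sum>i\<in>S. x i)\<^sup>2 \<le> (\<Sum>i\<in>S. w i) * (\<Sum>i\<in>S. (x i)\<^sup>2 / w i)"
proof -
  have "(\<Sum>i\<in>S. x i) = (\<Sum>i\<in>S. sqrt (w i) * (x i / sqrt (w i)))"
    using x w by (intro sum.cong) auto
  also have "\<dots>\<^sup>2 \<le> (\<Sum>i\<in>S. (sqrt (w i))\<^sup>2) * (\<Sum>i\<in>S. (x i / sqrt (w i))\<^sup>2)"
    by (rule Cauchy_Schwarz_ineq_sum)
  also have "\<dots> = (\<Sum>i\<in>S. w i) * (\<Sum>i\<in>S. (x i)\<^sup>2 / w i)"
    using w by (intro arg_cong2[where f = times] sum.cong) (auto simp: power_divide)
  finally show ?thesis .
qed

text \<open>The moment bound passes from one linear form to a family of them with the same constant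
  K. The weights w_r = |v_r|^2 are chosen so that each form contributes at most K w_r^2 / w_r = K
  w_r, and the prefactor \<open>sum w S\<close> completes the square. This is the step that makes
  tensorisation lossless.\<close>

lemma nn_integral_sum_norm_square_le:
  fixes \<mu> :: "(nat \<Rightarrow> complex) measure" and v :: "'b \<Rightarrow> nat \<Rightarrow> complex"
  assumes "finite S" and K: "0 \<le> K"
    and meas: "\<And>i. i < d \<Longrightarrow> (\<lambda>\<phi>. \<phi> i) \<in> borel_measurable \<mu>"
    and mom: "\<And>v. (\<integral>\<^sup>+\<phi>. ennreal (cmod (\<Sum>i<d. v i * \<phi> i) ^ 4) \<partial>\<mu>)
        \<le> ennreal (K * (\<Sum>i<d. (cmod (v i))\<^sup>2)\<^sup>2)"
  shows "(\<integral>\<^sup>+\<phi>. ennreal ((\<Sum>r\<in>S. (cmod (\<Sum>i<d. v r i * \<phi> i))\<^sup>2)\<^sup>2) \<partial>\<mu>)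
       \<le> ennreal (K * (\<Sum>r\<in>S. \<Sum>i<d. (cmod (v r i))\<^sup>2)\<^sup>2)"
proof -
  define w where "w r = (\<Sum>i<d. (cmod (v r i))\<^sup>2)" for r
  have w0: "0 \<le> w r" for r by (simp add: w_def sum_nonneg)
  have z: "(\<Sum>i<d. v r i * \<phi> i) = 0" if "w r = 0" for r \<phi>
    using that by (intro sum.neutral) (auto simp: w_def sum_nonneg_eq_0_iff)
  have [measurable]: "(\<lambda>\<phi>. \<Sum>i<d. v r i * \<phi> i) \<in> borel_measurable \<mu>" for r
    by (intro borel_measurable_sum borel_measurable_times borel_measurable_const meas) simp
  have "(\<integral>\<^sup>+\<phi>. ennreal ((\<Sum>r\<in>S. (cmod (\<Sum>i<d. v r i * \<phi> i))\<^sup>2)\<^sup>2) \<partial>\<mu>)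
     \<le> (\<integral>\<^sup>+\<phi>. (\<Sum>r\<in>S. ennreal (sum w S / w r) * ennreal (cmod (\<Sum>i<d. v r i * \<phi> i) ^ 4)) \<partial>\<mu>)"
  proof (rule nn_integral_mono)
    fix \<phi>
    have "(\<Sum>r\<in>S. (cmod (\<Sum>i<d. v r i * \<phi> i))\<^sup>2)\<^sup>2
        \<le> sum w S * (\<Sum>r\<in>S. ((cmod (\<Sum>i<d. v r i * \<phi> i))\<^sup>2)\<^sup>2 / w r)"
      using \<open>finite S\<close> w0 z by (intro sum_square_le_weighted) auto
    also have "\<dots> = (\<Sum>r\<in>S. sum w S / w r * cmod (\<Sum>i<d. v r i * \<phi> i) ^ 4)"
      by (simp add: sum_distrib_left flip: power_mult)
    finally show "ennreal ((\<Sum>r\<in>S. (cmod (\<Sum>i<d. v r i * \<phi> i))\<^sup>2)\<^sup>2)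
      \<le> (\<Sum>r\<in>S. ennreal (sum w S / w r) * ennreal (cmod (\<Sum>i<d. v r i * \<phi> i) ^ 4))"
      using w0 by (simp add: ennreal_leI sum_nonneg flip: ennreal_mult)
  qed
  also have "\<dots> = (\<Sum>r\<in>S. ennreal (sum w S / w r) * (\<integral>\<^sup>+\<phi>. ennreal (cmod (\<Sum>i<d. v r i * \<phi> i) ^ 4) \<partial>\<mu>))"
    by (simp add: nn_integral_sum nn_integral_cmult)
  also have "\<dots> \<le> (\<Sum>r\<in>S. ennreal (sum w S / w r) * ennreal (K * (w r)\<^sup>2))"
    unfolding w_def by (intro sum_mono mult_left_mono mom) simp
  also have "\<dots> = ennreal (\<Sum>r\<in>S. sum w S / w r * (K * (w r)\<^sup>2))"
    using w0 K by (simp add: sum_nonneg flip: ennreal_mult)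
  also have "(\<Sum>r\<in>S. sum w S / w r * (K * (w r)\<^sup>2)) = (\<Sum>r\<in>S. K * sum w S * w r)"
    by (intro sum.cong) (auto simp: power2_eq_square)
  also have "\<dots> = K * (sum w S)\<^sup>2"
    by (simp add: power2_eq_square mult.assoc flip: sum_distrib_left)
  finally show ?thesis by (simp add: w_def)
qed

text \<open>Contracting v with the state y of the last site leaves a vector \<open>?w y\<close> on
  the other n sites. It is again arbitrary, hence the generalisation over v in the induction. The
  induction hypothesis bounds the inner integral by the squared norm of \<open>?w y\<close>,
  squared, and the family version of the one-site bound integrates that over y.\<close>

lemma product_fourth_moment:
  fixes \<mu> :: "(nat \<Rightarrow> complex) measure"
  assumes "prob_space \<mu>" and d: "0 < d" and K: "0 \<le> K"
    and meas: "\<And>i. i < d \<Longrightarrow> (\<lambda>\<phi>. \<phi> i) \<in> borel_measurable \<mu>"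
    and mom: "\<And>v. (\<integral>\<^sup>+\<phi>. ennreal (cmod (\<Sum>i<d. v i * \<phi> i) ^ 4) \<partial>\<mu>)
        \<le> ennreal (K * (\<Sum>i<d. (cmod (v i))\<^sup>2)\<^sup>2)"
  shows "(\<integral>\<^sup>+\<phi>. ennreal (cmod (\<Sum>k<d ^ n. v k * (\<Prod>l<n. \<phi> l (k div d ^ l mod d))) ^ 4) \<partial>product_measure n \<mu>)
       \<le> ennreal (K ^ n * (\<Sum>k<d ^ n. (cmod (v k))\<^sup>2)\<^sup>2)"
proof (induction n arbitrary: v)
  case 0
  interpret P: prob_space "product_measure 0 \<mu>"
    unfolding product_measure_def by (intro prob_space_PiM assms)
  show ?case by (simp add: P.emeasure_space_1 flip: power_mult)
next
  case (Suc n)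
  interpret prob_space \<mu> by fact
  interpret P: product_sigma_finite "\<lambda>_::nat. \<mu>" by unfold_locales
  let ?w = "\<lambda>y r. \<Sum>a<d. v (r + a * d ^ n) * y a"
  have dn: "0 < d ^ n" using d by simp
  have ins: "{0..<Suc n} = insert n {0..<n}" by auto
  have split: "(\<Sum>k<d ^ Suc n. f k) = (\<Sum>r<d ^ n. \<Sum>a<d. f (r + a * d ^ n))" for f :: "nat \<Rightarrow> 'z::comm_monoid_add"
    using sum_split_last_digit[OF dn, where d = d and f = f] by (simp add: mult.commute)
  have amp: "(\<Sum>k<d ^ Suc n. v k * (\<Prod>l<Suc n. (x(n := y)) l (k div d ^ l mod d)))
      = (\<Sum>r<d ^ n. ?w y r * (\<Prod>l<n. x l (r div d ^ l mod d)))" for x y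
    unfolding split sum_distrib_right
  proof (intro sum.cong refl)
    fix r a assume "r \<in> {..<d ^ n}" "a \<in> {..<d}"
    then show "v (r + a * d ^ n) * (\<Prod>l<Suc n. (x(n := y)) l ((r + a * d ^ n) div d ^ l mod d))
       = v (r + a * d ^ n) * y a * (\<Prod>l<n. x l (r div d ^ l mod d))"
      using d by (simp add: digit_add_multiple)
  qed
  \<comment> \<open>Tonelli with the new site outermost, so that y is fixed while the induction
    hypothesis is applied to the other sites.\<close>
  have "(\<integral>\<^sup>+\<phi>. ennreal (cmod (\<Sum>k<d ^ Suc n. v k * (\<Prod>l<Suc n. \<phi> l (k div d ^ l mod d))) ^ 4) \<partial>product_measure (Suc n) \<mu>)
     = (\<integral>\<^sup>+y. \<integral>\<^sup>+x. ennreal (cmod (\<Sum>k<d ^ Suc n. v k * (\<Prod>l<Suc n. (x(n := y)) l (k div d ^ l mod d))) ^ 4) \<partial>product_measure n \<mu> \<partial>\<mu>)"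
    unfolding product_measure_def ins
  proof (rule P.product_nn_integral_insert_rev)
    have "(\<lambda>\<phi>. \<Sum>k<d ^ Suc n. v k * (\<Prod>l<Suc n. \<phi> l (k div d ^ l mod d)))
       \<in> borel_measurable (PiM (insert n {0..<n}) (\<lambda>_. \<mu>))"
      using borel_measurable_product_amplitude[OF d meas, where n = "Suc n"]
      unfolding product_measure_def ins .
    then show "(\<lambda>\<phi>. ennreal (cmod (\<Sum>k<d ^ Suc n. v k * (\<Prod>l<Suc n. \<phi> l (k div d ^ l mod d))) ^ 4))
       \<in> borel_measurable (PiM (insert n {0..<n}) (\<lambda>_. \<mu>))"
      by (intro measurable_compose[OF _ measurable_ennreal] borel_measurable_power
        measurable_compose[OF _ borel_measurable_norm])
  qed simp_all
  also have "\<dots> \<le> (\<integral>\<^sup>+y. ennreal (K ^ n * (\<Sum>r<d ^ n. (cmod (?w y r))\<^sup>2)\<^sup>2) \<partial>\<mu>)"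
    unfolding amp by (intro nn_integral_mono Suc.IH)
  also have "\<dots> = (\<integral>\<^sup>+y. ennreal (K ^ n) * ennreal ((\<Sum>r<d ^ n. (cmod (?w y r))\<^sup>2)\<^sup>2) \<partial>\<mu>)"
    using K by (simp add: ennreal_mult)
  also have "\<dots> = ennreal (K ^ n) * (\<integral>\<^sup>+y. ennreal ((\<Sum>r<d ^ n. (cmod (?w y r))\<^sup>2)\<^sup>2) \<partial>\<mu>)"
    using meas by (intro nn_integral_cmult measurable_compose[OF _ measurable_ennreal] borel_measurable_power
        measurable_compose[OF _ borel_measurable_norm] borel_measurable_sum borel_measurable_times
        borel_measurable_const) simp
  also have "\<dots> \<le> ennreal (K ^ n) * ennreal (K * (\<Sum>r<d ^ n. \<Sum>a<d. (cmod (v (r + a * d ^ n)))\<^sup>2)\<^sup>2)"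
    using K meas mom by (intro mult_left_mono nn_integral_sum_norm_square_le) simp_all
  also have "\<dots> = ennreal (K ^ Suc n * (\<Sum>k<d ^ Suc n. (cmod (v k))\<^sup>2)\<^sup>2)"
    unfolding split using K by (simp add: mult_ac flip: ennreal_mult)
  finally show ?case .
qed

subsection \<open>Time averages of trigonometric sums\<close>

lemma integrable_cis_interval: "(\<lambda>t. a * cis (\<omega> * t)) integrable_on {0..\<tau>}"
  by (intro integrable_continuous_real continuous_intros)

text \<open>A nonzero frequency has a bounded primitive, so its mean decays like 1 / \<tau>.\<close>

lemma tendsto_time_average_cis:
  "((\<lambda>\<tau>. integral {0..\<tau>} (\<lambda>t. cis (\<omega> * t)) / of_real \<tau>) \<longlongrightarrow> (if \<omega> = 0 then 1 else 0)) at_top"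
proof (cases "\<omega> = 0")
  case True
  have "\<forall>\<^sub>F \<tau> in at_top. integral {0..\<tau>} (\<lambda>t. cis (\<omega> * t)) / of_real \<tau> = 1"
    using eventually_gt_at_top[of 0] by eventually_elim (simp add: True scaleR_conv_of_real)
  then show ?thesis using True by (simp add: tendsto_eventually)
next
  case False
  have "((\<lambda>\<tau>. integral {0..\<tau>} (\<lambda>t. cis (\<omega> * t)) / of_real \<tau>) \<longlongrightarrow> 0) at_top"
  proof (rule Lim_null_comparison)
    show "((\<lambda>\<tau>. 2 / \<bar>\<omega>\<bar> / \<tau>) \<longlongrightarrow> 0) at_top"
      by (intro tendsto_divide_0[OF tendsto_const] filterlim_at_top_imp_at_infinity filterlim_ident)
    show "\<forall>\<^sub>F \<tau> in at_top. norm (integral {0..\<tau>} (\<lambda>t. cis (\<omega> * t)) / of_real \<tau>) \<le> 2 / \<bar>\<omega>\<bar> / \<tau>"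
      using eventually_gt_at_top[of 0]
    proof eventually_elim
      case (elim \<tau>)
      have "((\<lambda>t. cis (\<omega> * t)) has_integral (cis (\<omega> * \<tau>) / (\<i> * \<omega>) - cis (\<omega> * 0) / (\<i> * \<omega>))) {0..\<tau>}"
      proof (rule fundamental_theorem_of_calculus)
        fix t
        have "((\<lambda>t. cis (\<omega> * t)) has_vector_derivative (\<i> * \<omega> * cis (\<omega> * t))) (at t within {0..\<tau>})"
          unfolding cis_conv_exp
          by (auto intro!: derivative_eq_intros has_vector_derivative_real_field simp: algebra_simps)
        then show "((\<lambda>t. cis (\<omega> * t) / (\<i> * \<omega>)) has_vector_derivative cis (\<omega> * t)) (at t within {0..\<tau>})"
          using False by (auto intro!: derivative_eq_intros)
      qed (use elim in simp)
      then have "integral {0..\<tau>} (\<lambda>t. cis (\<omega> * t)) = (cis (\<omega> * \<tau>) - 1) / (\<i> * \<omega>)"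
        by (simp add: integral_unique diff_divide_distrib)
      moreover have "norm (cis (\<omega> * \<tau>) - 1) \<le> 2"
        using norm_triangle_ineq4[of "cis (\<omega> * \<tau>)" 1] by simp
      ultimately have "norm (integral {0..\<tau>} (\<lambda>t. cis (\<omega> * t))) \<le> 2 / \<bar>\<omega>\<bar>"
        by (simp add: norm_divide norm_mult divide_right_mono)
      then have "norm (integral {0..\<tau>} (\<lambda>t. cis (\<omega> * t))) / \<tau> \<le> 2 / \<bar>\<omega>\<bar> / \<tau>"
        using elim by (intro divide_right_mono) simp_all
      then show ?case using elim by (simp add: norm_divide)
    qed
  qed
  then show ?thesis using False by simp
qed

lemma tendsto_time_average_trig_sum:
  assumes "finite S"
  shows "((\<lambda>\<tau>. integral {0..\<tau>} (\<lambda>t. \<Sum>s\<in>S. a s * cis (\<omega> s * t)) / of_real \<tau>)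
           \<longlongrightarrow> (\<Sum>s\<in>S. if \<omega> s = 0 then a s else 0)) at_top"
proof -
  have "(\<lambda>\<tau>. integral {0..\<tau>} (\<lambda>t. \<Sum>s\<in>S. a s * cis (\<omega> s * t)) / of_real \<tau>)
      = (\<lambda>\<tau>. \<Sum>s\<in>S. a s * (integral {0..\<tau>} (\<lambda>t. cis (\<omega> s * t)) / of_real \<tau>))"
    using assms by (simp add: integral_sum integrable_cis_interval sum_divide_distrib)
  moreover have "((\<lambda>\<tau>. \<Sum>s\<in>S. a s * (integral {0..\<tau>} (\<lambda>t. cis (\<omega> s * t)) / of_real \<tau>))
      \<longlongrightarrow> (\<Sum>s\<in>S. a s * (if \<omega> s = 0 then 1 else 0))) at_top"
    by (intro tendsto_sum tendsto_mult tendsto_const tendsto_time_average_cis)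
  ultimately show ?thesis by (simp add: if_distrib cong: if_cong)
qed

lemma time_avg_trig_sum:
  assumes "finite S"
  shows "time_avg (\<lambda>t. \<Sum>s\<in>S. a s * cis (\<omega> s * t)) = (\<Sum>s\<in>S. if \<omega> s = 0 then a s else 0)"
  unfolding time_avg_def
  by (rule tendsto_Lim[OF _ tendsto_time_average_trig_sum[OF assms]]) simp

text \<open>Parseval for almost periodic sums: expanding the square produces the frequencies
  \<open>\<omega> s - \<omega> s'\<close>, and injectivity leaves only the diagonal with frequency
  zero.\<close>

lemma time_avg_real_trig_sum_square:
  fixes \<omega> :: "'a \<Rightarrow> real"
  assumes S: "finite S" and inj: "inj_on \<omega> S"
  shows "time_avg_real (\<lambda>t. (cmod (\<Sum>s\<in>S. a s * cis (\<omega> s * t)))\<^sup>2) = (\<Sum>s\<in>S. (cmod (a s))\<^sup>2)"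
proof -
  let ?f = "\<lambda>t. \<Sum>p\<in>S \<times> S. (a (fst p) * cnj (a (snd p))) * cis ((\<omega> (fst p) - \<omega> (snd p)) * t)"
  have f: "complex_of_real ((cmod (\<Sum>s\<in>S. a s * cis (\<omega> s * t)))\<^sup>2) = ?f t" for t
    unfolding complex_norm_square cnj_sum sum_product sum.cartesian_product
    by (intro sum.cong) (auto simp: cis_cnj cis_mult algebra_simps)
  have int: "?f integrable_on {0..\<tau>}" for \<tau>
    using S by (intro integrable_sum integrable_cis_interval) simp
  have "(\<Sum>p\<in>S \<times> S. if \<omega> (fst p) - \<omega> (snd p) = 0 then a (fst p) * cnj (a (snd p)) else 0)
      = (\<Sum>s\<in>S. \<Sum>s'\<in>S. if s' = s then a s * cnj (a s) else 0)"
    unfolding sum.cartesian_product using inj by (intro sum.cong) (auto dest: inj_onD)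
  also have "\<dots> = of_real (\<Sum>s\<in>S. (cmod (a s))\<^sup>2)"
    using S by (simp add: complex_norm_square del: of_real_power)
  finally have lim: "((\<lambda>\<tau>. integral {0..\<tau>} ?f / of_real \<tau>) \<longlongrightarrow> of_real (\<Sum>s\<in>S. (cmod (a s))\<^sup>2)) at_top"
    using tendsto_time_average_trig_sum[of "S \<times> S" "\<lambda>p. a (fst p) * cnj (a (snd p))"
      "\<lambda>p. \<omega> (fst p) - \<omega> (snd p)"] S by simp
  have "Re (integral {0..\<tau>} ?f / of_real \<tau>) = integral {0..\<tau>} (\<lambda>t. (cmod (\<Sum>s\<in>S. a s * cis (\<omega> s * t)))\<^sup>2) / \<tau>" for \<tau>
  proof -
    have "Re (integral {0..\<tau>} ?f) = integral {0..\<tau>} (Re \<circ> ?f)"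
      by (rule integral_linear[OF int bounded_linear_Re, symmetric])
    also have "Re \<circ> ?f = (\<lambda>t. (cmod (\<Sum>s\<in>S. a s * cis (\<omega> s * t)))\<^sup>2)"
      unfolding comp_def f[symmetric] Re_complex_of_real ..
    finally show ?thesis by (simp only: Re_divide_of_real)
  qed
  then have "((\<lambda>\<tau>. integral {0..\<tau>} (\<lambda>t. (cmod (\<Sum>s\<in>S. a s * cis (\<omega> s * t)))\<^sup>2) / \<tau>)
      \<longlongrightarrow> (\<Sum>s\<in>S. (cmod (a s))\<^sup>2)) at_top"
    using tendsto_Re[OF lim] by (simp only: Re_complex_of_real)
  then show ?thesis unfolding time_avg_real_def by (intro tendsto_Lim) simp_all
qed

text \<open>Subtracting the mean deletes exactly the terms of frequency zero, so injectivity is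
  asked of the remaining ones only. In the application all pairs (i, i) share the frequency
  zero.\<close>

lemma time_variance_trig_sum:
  fixes \<omega> :: "'a \<Rightarrow> real" and a :: "'a \<Rightarrow> complex"
  assumes S: "finite S" and inj: "inj_on \<omega> {s\<in>S. \<omega> s \<noteq> 0}"
  defines "f \<equiv> \<lambda>t. \<Sum>s\<in>S. a s * cis (\<omega> s * t)"
  shows "time_avg_real (\<lambda>t. (cmod (f t - time_avg f))\<^sup>2) = (\<Sum>s\<in>{s\<in>S. \<omega> s \<noteq> 0}. (cmod (a s))\<^sup>2)"
proof -
  have "f t - time_avg f = (\<Sum>s\<in>{s\<in>S. \<omega> s \<noteq> 0}. a s * cis (\<omega> s * t))" for t
  proof -
    have "f t - time_avg f = (\<Sum>s\<in>S. a s * cis (\<omega> s * t) - (if \<omega> s = 0 then a s else 0))"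
      unfolding f_def time_avg_trig_sum[OF S] by (simp add: sum_subtractf)
    also have "\<dots> = (\<Sum>s\<in>S. if \<omega> s \<noteq> 0 then a s * cis (\<omega> s * t) else 0)"
      by (intro sum.cong) auto
    finally show ?thesis using S by (simp add: sum.inter_filter)
  qed
  then show ?thesis using time_avg_real_trig_sum_square[OF _ inj] S by simp
qed

subsection \<open>Orthonormal bases and the operator norm\<close>

text \<open>\<open>u j k\<close> is the k-th component of the j-th vector. In this encoding a change
  of basis is an interchange of finite sums.\<close>

locale orthonormal_basis_fun =
  fixes D :: nat and u :: "nat \<Rightarrow> nat \<Rightarrow> complex"
  assumes orthonormal: "i < D \<Longrightarrow> j < D \<Longrightarrow> (\<Sum>k<D. cnj (u i k) * u j k) = (if i = j then 1 else 0)"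
begin

text \<open>There are as many vectors as dimensions, and a left inverse of a square matrix is a
  right inverse.\<close>

lemma complete:
  assumes "i < D" "k < D"
  shows "(\<Sum>j<D. u j i * cnj (u j k)) = (if i = k then 1 else 0)"
proof -
  define U where "U = mat D D (\<lambda>(i,j). u j i)"
  define V where "V = mat D D (\<lambda>(i,j). cnj (u i j))"
  have "V * U = 1\<^sub>m D"
    by (rule eq_matI) (simp_all add: U_def V_def scalar_prod_def orthonormal flip: lessThan_atLeast0)
  then have "U * V = 1\<^sub>m D"
    by (rule mat_mult_left_right_inverse[rotated 2]) (simp_all add: U_def V_def)
  then have "(U * V) $$ (i,k) = 1\<^sub>m D $$ (i,k)" by simp
  then show ?thesis using assms by (simp add: U_def V_def scalar_prod_def flip: lessThan_atLeast0)
qed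

lemma norm_square_basis: "j < D \<Longrightarrow> (\<Sum>k<D. (cmod (u j k))\<^sup>2) = 1"
proof -
  assume j: "j < D"
  have "complex_of_real (\<Sum>k<D. (cmod (u j k))\<^sup>2) = (\<Sum>k<D. cnj (u j k) * u j k)"
    by (simp add: complex_norm_square mult.commute del: of_real_power)
  also have "\<dots> = 1" using orthonormal[OF j j] by simp
  finally show ?thesis by (metis of_real_eq_1_iff)
qed

lemma parseval: "(\<Sum>j<D. (cmod (\<Sum>k<D. cnj (u j k) * x k))\<^sup>2) = (\<Sum>k<D. (cmod (x k))\<^sup>2)"
proof -
  have "complex_of_real (\<Sum>j<D. (cmod (\<Sum>k<D. cnj (u j k) * x k))\<^sup>2)
     = (\<Sum>j<D. \<Sum>k<D. \<Sum>l<D. (x k * cnj (x l)) * (u j l * cnj (u j k)))"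
    unfolding of_real_sum complex_norm_square cnj_sum sum_product
    by (intro sum.cong) (simp_all add: mult_ac)
  also have "\<dots> = (\<Sum>k<D. \<Sum>l<D. (x k * cnj (x l)) * (\<Sum>j<D. u j l * cnj (u j k)))"
    unfolding sum_distrib_left by (subst sum.swap, intro sum.cong refl sum.swap)
  also have "\<dots> = (\<Sum>k<D. \<Sum>l<D. if l = k then x k * cnj (x l) else 0)"
    by (intro sum.cong) (auto simp: complete)
  also have "\<dots> = complex_of_real (\<Sum>k<D. (cmod (x k))\<^sup>2)"
    by (simp add: complex_norm_square del: of_real_power)
  finally show ?thesis by (simp only: of_real_eq_iff)
qed

text \<open>The form for row vectors, used where \<open>mat_elem\<close> is summed over its second
  index.\<close>

lemma parseval': "(\<Sum>j<D. (cmod (\<Sum>k<D. x k * u j k))\<^sup>2) = (\<Sum>k<D. (cmod (x k))\<^sup>2)"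
proof -
  have "cmod (\<Sum>k<D. x k * u j k) = cmod (\<Sum>k<D. cnj (u j k) * cnj (x k))" for j
    by (subst complex_mod_cnj[symmetric]) (simp add: mult.commute)
  then show ?thesis using parseval[of "\<lambda>k. cnj (x k)"] by simp
qed

end

lemma norm_sum_mult_le:
  fixes x y :: "'a \<Rightarrow> complex"
  shows "(cmod (\<Sum>i\<in>S. x i * y i))\<^sup>2 \<le> (\<Sum>i\<in>S. (cmod (x i))\<^sup>2) * (\<Sum>i\<in>S. (cmod (y i))\<^sup>2)"
proof -
  have "(cmod (\<Sum>i\<in>S. x i * y i))\<^sup>2 \<le> (\<Sum>i\<in>S. cmod (x i) * cmod (y i))\<^sup>2"
    by (intro power_mono norm_ge_zero order_trans[OF norm_sum]) (simp add: norm_mult)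
  also have "\<dots> \<le> (\<Sum>i\<in>S. (cmod (x i))\<^sup>2) * (\<Sum>i\<in>S. (cmod (y i))\<^sup>2)"
    by (rule Cauchy_Schwarz_ineq_sum)
  finally show ?thesis .
qed

lemma vnorm_square: "(vnorm v)\<^sup>2 = (\<Sum>i<dim_vec v. (cmod (v $ i))\<^sup>2)"
  by (simp add: vnorm_def sum_nonneg)

lemma mult_mat_vec_index_sum:
  assumes "A \<in> carrier_mat m n" "v \<in> carrier_vec n" "i < m"
  shows "(A *\<^sub>v v) $ i = (\<Sum>k<n. A $$ (i,k) * v $ k)"
  using assms by (auto simp: scalar_prod_def lessThan_atLeast0)

lemma vnorm_smult: "vnorm (c \<cdot>\<^sub>v v) = cmod c * vnorm v"
  by (simp add: vnorm_def norm_mult power_mult_distrib real_sqrt_mult flip: sum_distrib_left)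

text \<open>\<open>op_norm\<close> is a supremum of reals, which bounds its members only once the
  set is known to be bounded above; the Frobenius norm supplies a bound.\<close>

lemma vnorm_mult_mat_vec_le_op_norm:
  assumes A: "A \<in> carrier_mat D D" and v: "v \<in> carrier_vec D"
  shows "vnorm (A *\<^sub>v v) \<le> op_norm D A * vnorm v"
proof -
  define F where "F = (\<Sum>i<D. \<Sum>k<D. (cmod (A $$ (i,k)))\<^sup>2)"
  have frob: "(vnorm (A *\<^sub>v x))\<^sup>2 \<le> F * (vnorm x)\<^sup>2" if x: "x \<in> carrier_vec D" for x
  proof -
    have "(vnorm (A *\<^sub>v x))\<^sup>2 = (\<Sum>i<D. (cmod (\<Sum>k<D. A $$ (i,k) * x $ k))\<^sup>2)"
      using A x by (simp add: vnorm_square mult_mat_vec_index_sum[OF A x] del: index_mult_mat_vec)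
    also have "\<dots> \<le> (\<Sum>i<D. (\<Sum>k<D. (cmod (A $$ (i,k)))\<^sup>2) * (\<Sum>k<D. (cmod (x $ k))\<^sup>2))"
      by (intro sum_mono norm_sum_mult_le)
    also have "\<dots> = F * (vnorm x)\<^sup>2"
      using x by (simp add: F_def vnorm_square sum_distrib_right)
    finally show ?thesis .
  qed
  have F0: "0 \<le> F" by (simp add: F_def sum_nonneg)
  have bdd: "bdd_above {vnorm (A *\<^sub>v x) | x. x \<in> carrier_vec D \<and> vnorm x \<le> 1}"
  proof (rule bdd_aboveI)
    fix y assume "y \<in> {vnorm (A *\<^sub>v x) | x. x \<in> carrier_vec D \<and> vnorm x \<le> 1}"
    then obtain x where x: "x \<in> carrier_vec D" "vnorm x \<le> 1" and y: "y = vnorm (A *\<^sub>v x)" by blast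
    have "0 \<le> vnorm x" by (simp add: vnorm_def sum_nonneg)
    then have "(vnorm x)\<^sup>2 \<le> 1" using x by (simp add: power_le_one_iff)
    then have "y\<^sup>2 \<le> F" unfolding y using frob[OF x(1)] F0 mult_left_le by fastforce
    then show "y \<le> sqrt F" by (rule real_le_rsqrt)
  qed
  have pos: "0 \<le> vnorm x" for x by (simp add: vnorm_def sum_nonneg)
  show ?thesis
  \<comment> \<open>A vector of norm 0 cannot be rescaled to norm 1; there the Frobenius estimate
    already forces the left side to be 0.\<close>
  proof (cases "vnorm v = 0")
    case True
    then show ?thesis using frob[OF v] pos[of "A *\<^sub>v v"] by simp
  next
    case False
    define w where "w = complex_of_real (1 / vnorm v) \<cdot>\<^sub>v v"
    have w: "w \<in> carrier_vec D" using v by (simp add: w_def)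
    have "vnorm w = 1" unfolding w_def vnorm_smult using False pos[of v] by (simp add: norm_divide)
    then have "vnorm (A *\<^sub>v w) \<le> op_norm D A"
      unfolding op_norm_def using w by (intro cSup_upper[OF _ bdd]) auto
    moreover have "A *\<^sub>v w = complex_of_real (1 / vnorm v) \<cdot>\<^sub>v (A *\<^sub>v v)"
      unfolding w_def by (rule mult_mat_vec[OF A v])
    then have "vnorm (A *\<^sub>v w) = vnorm (A *\<^sub>v v) / vnorm v"
      unfolding vnorm_smult using pos[of v] by (simp add: vnorm_smult norm_divide)
    ultimately show ?thesis using False pos[of v] by (simp add: divide_le_eq)
  qed
qed

lemma sum_norm_square_mat_le:
  assumes A: "A \<in> carrier_mat D D" and M: "op_norm D A \<le> M"
  shows "(\<Sum>i<D. (cmod (\<Sum>k<D. A $$ (i,k) * x k))\<^sup>2) \<le> M\<^sup>2 * (\<Sum>k<D. (cmod (x k))\<^sup>2)"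
proof -
  have v: "vec D x \<in> carrier_vec D" by simp
  have pos: "0 \<le> vnorm y" for y by (simp add: vnorm_def sum_nonneg)
  have "vnorm (A *\<^sub>v vec D x) \<le> op_norm D A * vnorm (vec D x)"
    by (rule vnorm_mult_mat_vec_le_op_norm[OF A v])
  also have "\<dots> \<le> M * vnorm (vec D x)" by (intro mult_right_mono M pos)
  finally have "(vnorm (A *\<^sub>v vec D x))\<^sup>2 \<le> M\<^sup>2 * (vnorm (vec D x))\<^sup>2"
    using power_mono[OF _ pos] by (metis power_mult_distrib)
  then show ?thesis using A
    by (simp add: vnorm_square mult_mat_vec_index_sum[OF A v] del: index_mult_mat_vec)
qed

context orthonormal_basis_fun
begin

definition coeff :: "(nat \<Rightarrow> complex) \<Rightarrow> nat \<Rightarrow> complex" where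
  "coeff x j = (\<Sum>k<D. cnj (u j k) * x k)"

definition mat_elem :: "complex mat \<Rightarrow> nat \<Rightarrow> nat \<Rightarrow> complex" where
  "mat_elem A i j = (\<Sum>l<D. cnj (u i l) * (\<Sum>k<D. A $$ (l,k) * u j k))"

text \<open>Column j lists the coordinates of A u_j in the basis, so by Parseval the sum is the
  squared norm of A u_j.\<close>

lemma mat_elem_column_le:
  assumes "A \<in> carrier_mat D D" "op_norm D A \<le> M" "j < D"
  shows "(\<Sum>i<D. (cmod (mat_elem A i j))\<^sup>2) \<le> M\<^sup>2"
  unfolding mat_elem_def parseval
  using sum_norm_square_mat_le[OF assms(1,2), of "u j"] norm_square_basis[OF assms(3)] by simp

text \<open>The row \<open>g\<close> of \<open>A\<close> in the direction \<open>u i\<close> is tested against its own conjugate, which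
  avoids passing to the adjoint of \<open>A\<close>.\<close>
lemma mat_elem_row_le:
  assumes A: "A \<in> carrier_mat D D" "op_norm D A \<le> M" and i: "i < D"
  shows "(\<Sum>j<D. (cmod (mat_elem A i j))\<^sup>2) \<le> M\<^sup>2"
proof -
  define g where "g k = (\<Sum>l<D. cnj (u i l) * A $$ (l,k))" for k
  have swap: "(\<Sum>l<D. cnj (u i l) * (\<Sum>k<D. A $$ (l,k) * x k)) = (\<Sum>k<D. g k * x k)" for x
    unfolding g_def sum_distrib_left sum_distrib_right mult.assoc by (rule sum.swap)
  define G where "G = (\<Sum>k<D. (cmod (g k))\<^sup>2)"
  have "complex_of_real G = (\<Sum>k<D. g k * cnj (g k))"
    by (simp add: G_def complex_norm_square del: of_real_power)
  then have "G\<^sup>2 = (cmod (\<Sum>l<D. cnj (u i l) * (\<Sum>k<D. A $$ (l,k) * cnj (g k))))\<^sup>2"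
    unfolding swap by (metis norm_of_real power2_abs)
  also have "\<dots> \<le> (\<Sum>l<D. (cmod (cnj (u i l)))\<^sup>2) * (\<Sum>l<D. (cmod (\<Sum>k<D. A $$ (l,k) * cnj (g k)))\<^sup>2)"
    by (rule norm_sum_mult_le)
  also have "\<dots> = (\<Sum>l<D. (cmod (\<Sum>k<D. A $$ (l,k) * cnj (g k)))\<^sup>2)"
    by (simp add: norm_square_basis[OF i])
  also have "\<dots> \<le> M\<^sup>2 * G"
    using sum_norm_square_mat_le[OF A, of "\<lambda>k. cnj (g k)"] by (simp add: G_def)
  finally have "G * G \<le> M\<^sup>2 * G" by (simp add: power2_eq_square)
  moreover have "0 \<le> G" by (simp add: G_def sum_nonneg)
  ultimately have "G \<le> M\<^sup>2" by (cases "G = 0") auto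
  then show ?thesis unfolding mat_elem_def swap parseval' G_def .
qed

text \<open>Schur's test for the nonnegative matrix |A_ij|^2, whose row and column sums are at most
  M^2.\<close>

lemma sum_mat_elem_weighted_le:
  fixes p :: "nat \<Rightarrow> real"
  assumes A: "A \<in> carrier_mat D D" "op_norm D A \<le> M"
  shows "(\<Sum>i<D. \<Sum>j<D. p i * p j * (cmod (mat_elem A i j))\<^sup>2) \<le> M\<^sup>2 * (\<Sum>j<D. (p j)\<^sup>2)"
proof -
  let ?B = "\<lambda>i j. (cmod (mat_elem A i j))\<^sup>2"
  have "(\<Sum>i<D. \<Sum>j<D. p i * p j * ?B i j) \<le> (\<Sum>i<D. \<Sum>j<D. (p i)\<^sup>2 / 2 * ?B i j + (p j)\<^sup>2 / 2 * ?B i j)"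
  proof (intro sum_mono)
    fix i j
    have "p i * p j \<le> (p i)\<^sup>2 / 2 + (p j)\<^sup>2 / 2"
      using sum_squares_bound[of "p i" "p j"] by simp
    from mult_right_mono[OF this, of "?B i j"]
    show "p i * p j * ?B i j \<le> (p i)\<^sup>2 / 2 * ?B i j + (p j)\<^sup>2 / 2 * ?B i j"
      by (simp add: distrib_right)
  qed
  also have "\<dots> = (\<Sum>i<D. (p i)\<^sup>2 / 2 * (\<Sum>j<D. ?B i j)) + (\<Sum>j<D. (p j)\<^sup>2 / 2 * (\<Sum>i<D. ?B i j))"
    unfolding sum.distrib sum_distrib_left by (subst (2) sum.swap) (rule refl)
  also have "\<dots> \<le> (\<Sum>i<D. (p i)\<^sup>2 / 2 * M\<^sup>2) + (\<Sum>j<D. (p j)\<^sup>2 / 2 * M\<^sup>2)"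
    by (intro add_mono sum_mono mult_left_mono mat_elem_row_le[OF A] mat_elem_column_le[OF A]) auto
  also have "\<dots> = M\<^sup>2 * (\<Sum>j<D. (p j)\<^sup>2)"
    by (simp add: sum_distrib_left mult.commute flip: sum.distrib)
  finally show ?thesis .
qed

end

subsection \<open>Dynamics in the energy eigenbasis\<close>

lemma hermitian_mat_cnj_entry:
  assumes "hermitian_mat D H" "i < D" "j < D"
  shows "cnj (H $$ (i,j)) = H $$ (j,i)"
  using assms unfolding hermitian_mat_def by (metis complex_cnj_cnj)

locale energy_eigenbasis = orthonormal_basis_fun +
  fixes H :: "complex mat" and e :: "nat \<Rightarrow> real"
  assumes H: "hermitian_mat D H"
    and eigen: "j < D \<Longrightarrow> i < D \<Longrightarrow> (\<Sum>k<D. H $$ (i,k) * u j k) = e j * u j i"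
begin

lemma H_carrier: "H \<in> carrier_mat D D"
  using H by (simp add: hermitian_mat_def)

lemma eigen_left:
  assumes "j < D" "k < D"
  shows "(\<Sum>l<D. cnj (u j l) * H $$ (l,k)) = e j * cnj (u j k)"
proof -
  have "(\<Sum>l<D. cnj (u j l) * H $$ (l,k)) = cnj (\<Sum>l<D. H $$ (k,l) * u j l)"
    unfolding cnj_sum using assms(2) by (intro sum.cong) (auto simp: hermitian_mat_cnj_entry[OF H])
  then show ?thesis using eigen[OF assms] by simp
qed

text \<open>Spectral decomposition of a power, with \<open>complete\<close> as the base case. The
  scalar z stays inside the power so that the terms are those of the exponential series.\<close>

lemma pow_smult_entry:
  assumes "i < D" "k < D"
  shows "((z \<cdot>\<^sub>m H) ^\<^sub>m m) $$ (i,k) = (\<Sum>j<D. u j i * cnj (u j k) * (z * e j) ^ m)"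
  using assms(2)
proof (induction m arbitrary: k)
  case 0
  then show ?case using assms(1) H_carrier by (simp add: complete)
next
  case (Suc m)
  have X: "z \<cdot>\<^sub>m H \<in> carrier_mat D D" using H_carrier by simp
  have "((z \<cdot>\<^sub>m H) ^\<^sub>m Suc m) $$ (i,k) = (\<Sum>l<D. ((z \<cdot>\<^sub>m H) ^\<^sub>m m) $$ (i,l) * (z * H $$ (l,k)))"
    using X assms(1) Suc.prems pow_carrier_mat[OF X, of m] H_carrier
    by (auto simp: scalar_prod_def lessThan_atLeast0 intro!: sum.cong)
  also have "\<dots> = (\<Sum>l<D. \<Sum>j<D. (u j i * (z * e j) ^ m * z) * (cnj (u j l) * H $$ (l,k)))"
    using Suc.IH by (intro sum.cong) (auto simp: sum_distrib_left mult_ac)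
  also have "\<dots> = (\<Sum>j<D. (u j i * (z * e j) ^ m * z) * (\<Sum>l<D. cnj (u j l) * H $$ (l,k)))"
    unfolding sum_distrib_left by (rule sum.swap)
  also have "\<dots> = (\<Sum>j<D. u j i * cnj (u j k) * (z * e j) ^ Suc m)"
    using Suc.prems by (intro sum.cong) (simp_all add: eigen_left mult_ac)
  finally show ?case .
qed

lemma mat_exp_carrier: "mat_exp (z \<cdot>\<^sub>m H) \<in> carrier_mat D D"
  using H_carrier by (simp add: mat_exp_def)

lemma mat_exp_entry:
  assumes "i < D" "k < D"
  shows "mat_exp (z \<cdot>\<^sub>m H) $$ (i,k) = (\<Sum>j<D. u j i * cnj (u j k) * exp (z * e j))"
proof -
  have "(\<lambda>m. \<Sum>j<D. u j i * cnj (u j k) * ((z * e j) ^ m /\<^sub>R fact m))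
      sums (\<Sum>j<D. u j i * cnj (u j k) * exp (z * e j))"
    by (intro sums_sum sums_mult exp_converges)
  moreover have "((z \<cdot>\<^sub>m H) ^\<^sub>m m) $$ (i,k) / of_nat (fact m)
      = (\<Sum>j<D. u j i * cnj (u j k) * ((z * e j) ^ m /\<^sub>R fact m))" for m
    by (simp add: pow_smult_entry[OF assms] sum_divide_distrib sum_distrib_left scaleR_conv_of_real divide_inverse mult_ac)
  ultimately have "(\<Sum>m. ((z \<cdot>\<^sub>m H) ^\<^sub>m m) $$ (i,k) / of_nat (fact m))
      = (\<Sum>j<D. u j i * cnj (u j k) * exp (z * e j))"
    by (simp add: sums_iff)
  then show ?thesis using assms H_carrier by (simp add: mat_exp_def)
qed

lemma mat_exp_mult_vec:
  assumes "i < D" "v \<in> carrier_vec D"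
  shows "(mat_exp (z \<cdot>\<^sub>m H) *\<^sub>v v) $ i = (\<Sum>j<D. u j i * exp (z * e j) * coeff (($) v) j)"
proof -
  have "(mat_exp (z \<cdot>\<^sub>m H) *\<^sub>v v) $ i
      = (\<Sum>k<D. \<Sum>j<D. (u j i * exp (z * e j)) * (cnj (u j k) * v $ k))"
    using assms by (simp add: mult_mat_vec_index_sum[OF mat_exp_carrier] mat_exp_entry
        sum_distrib_left mult_ac del: index_mult_mat_vec)
  then show ?thesis
    unfolding coeff_def sum_distrib_left by (subst (asm) sum.swap)
qed

text \<open>In the energy basis the evolution multiplies each amplitude by a phase. The double sum
  is indexed by pairs to give it the shape of a trigonometric sum whose frequencies are the
  gaps.\<close>

lemma expect_heis:
  assumes A: "A \<in> carrier_mat D D" and \<psi>: "\<psi> \<in> carrier_vec D"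
  shows "expect (heis H A t) \<psi>
    = (\<Sum>p\<in>{..<D} \<times> {..<D}. (cnj (coeff (($) \<psi>) (fst p)) * mat_elem A (fst p) (snd p) * coeff (($) \<psi>) (snd p))
        * cis ((e (fst p) - e (snd p)) * t))"
proof -
  let ?c = "coeff (($) \<psi>)"
  define E1 E2 where "E1 = mat_exp ((\<i> * of_real t) \<cdot>\<^sub>m H)" and "E2 = mat_exp ((- \<i> * of_real t) \<cdot>\<^sub>m H)"
  have E: "E1 \<in> carrier_mat D D" "E2 \<in> carrier_mat D D"
    unfolding E1_def E2_def by (rule mat_exp_carrier)+
  define x where "x = E2 *\<^sub>v \<psi>"
  have x: "x \<in> carrier_vec D" "A *\<^sub>v x \<in> carrier_vec D"
    using E A unfolding x_def carrier_vec_def by auto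
  have heis: "heis H A t *\<^sub>v \<psi> = E1 *\<^sub>v (A *\<^sub>v x)"
    unfolding heis_def x_def E1_def[symmetric] E2_def[symmetric]
    using E A \<psi> by (simp add: assoc_mult_mat_vec[of _ D D _ D])
  have x_entry: "x $ k = (\<Sum>j<D. u j k * exp (- \<i> * t * e j) * ?c j)" if "k < D" for k
    unfolding x_def E2_def using that \<psi> by (simp add: mat_exp_mult_vec)
  have coeff_A: "coeff (($) (A *\<^sub>v x)) i = (\<Sum>j<D. exp (- \<i> * t * e j) * ?c j * mat_elem A i j)" for i
  proof -
    have "coeff (($) (A *\<^sub>v x)) i
        = (\<Sum>l<D. cnj (u i l) * (\<Sum>k<D. A $$ (l,k) * (\<Sum>j<D. u j k * exp (- \<i> * t * e j) * ?c j)))"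
      unfolding coeff_def[of "($) (A *\<^sub>v x)"]
      by (intro sum.cong refl arg_cong2[where f = times])
        (simp add: mult_mat_vec_index_sum[OF A x(1)] x_entry del: index_mult_mat_vec)
    also have "\<dots> = (\<Sum>l<D. \<Sum>k<D. \<Sum>j<D. (exp (- \<i> * t * e j) * ?c j) * (cnj (u i l) * (A $$ (l,k) * u j k)))"
      by (simp add: sum_distrib_left mult_ac)
    also have "\<dots> = (\<Sum>j<D. \<Sum>l<D. \<Sum>k<D. (exp (- \<i> * t * e j) * ?c j) * (cnj (u i l) * (A $$ (l,k) * u j k)))"
      by (rule trans[OF sum.cong[OF refl sum.swap] sum.swap])
    finally show ?thesis by (simp add: mat_elem_def sum_distrib_left)
  qed
  have "expect (heis H A t) \<psi> = (\<Sum>a<D. cnj (\<psi> $ a) * (\<Sum>i<D. u i a * exp (\<i> * t * e i) * coeff (($) (A *\<^sub>v x)) i))"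
    using \<psi> x(2) by (simp add: expect_def heis E1_def mat_exp_mult_vec del: index_mult_mat_vec)
  also have "\<dots> = (\<Sum>a<D. \<Sum>i<D. (exp (\<i> * t * e i) * coeff (($) (A *\<^sub>v x)) i) * (u i a * cnj (\<psi> $ a)))"
    by (simp add: sum_distrib_left mult_ac)
  also have "\<dots> = (\<Sum>i<D. (exp (\<i> * t * e i) * coeff (($) (A *\<^sub>v x)) i) * cnj (?c i))"
    by (subst sum.swap) (simp add: coeff_def sum_distrib_left)
  also have "\<dots> = (\<Sum>i<D. \<Sum>j<D. (cnj (?c i) * mat_elem A i j * ?c j) * cis ((e i - e j) * t))"
  proof (intro sum.cong refl)
    fix i
    have "cis ((e i - e j) * t) = exp (\<i> * t * e i) * exp (- \<i> * t * e j)" for j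
      unfolding cis_conv_exp by (simp add: algebra_simps flip: exp_add)
    then show "(exp (\<i> * t * e i) * coeff (($) (A *\<^sub>v x)) i) * cnj (?c i)
      = (\<Sum>j<D. (cnj (?c i) * mat_elem A i j * ?c j) * cis ((e i - e j) * t))"
      by (simp add: coeff_A sum_distrib_left mult_ac)
  qed
  finally show ?thesis by (simp add: sum.cartesian_product split_beta)
qed

end

locale nondegenerate_energy_eigenbasis = energy_eigenbasis +
  assumes gaps: "inj_on (\<lambda>p. e (fst p) - e (snd p)) {p\<in>{..<D} \<times> {..<D}. fst p \<noteq> snd p}"
begin

text \<open>Two equal levels i and j would give the distinct pairs (i, j) and (j, i) the same gap
  0.\<close>

lemma e_eq_iff: "i < D \<Longrightarrow> j < D \<Longrightarrow> e i = e j \<longleftrightarrow> i = j"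
  using inj_onD[OF gaps, of "(i,j)" "(j,i)"] by auto

lemma DeltaA_inf_eq:
  assumes A: "A \<in> carrier_mat D D" and \<psi>: "\<psi> \<in> carrier_vec D"
  shows "DeltaA_inf H A \<psi> = (\<Sum>p\<in>{p\<in>{..<D} \<times> {..<D}. fst p \<noteq> snd p}.
     (cmod (cnj (coeff (($) \<psi>) (fst p)) * mat_elem A (fst p) (snd p) * coeff (($) \<psi>) (snd p)))\<^sup>2)"
proof -
  have "{p\<in>{..<D} \<times> {..<D}. e (fst p) - e (snd p) \<noteq> 0} = {p\<in>{..<D} \<times> {..<D}. fst p \<noteq> snd p}"
    using e_eq_iff by auto
  then show ?thesis
    unfolding DeltaA_inf_def A_inf_def expect_heis[OF A \<psi>]
    using time_variance_trig_sum[of "{..<D} \<times> {..<D}" "\<lambda>p. e (fst p) - e (snd p)"] gaps by simp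
qed

lemma DeltaA_inf_le:
  assumes A: "A \<in> carrier_mat D D" "op_norm D A \<le> M" and \<psi>: "\<psi> \<in> carrier_vec D"
  shows "DeltaA_inf H A \<psi> \<le> M\<^sup>2 * (\<Sum>j<D. cmod (coeff (($) \<psi>) j) ^ 4)"
proof -
  let ?p = "\<lambda>j. (cmod (coeff (($) \<psi>) j))\<^sup>2"
  have "DeltaA_inf H A \<psi> \<le> (\<Sum>p\<in>{..<D} \<times> {..<D}.
     (cmod (cnj (coeff (($) \<psi>) (fst p)) * mat_elem A (fst p) (snd p) * coeff (($) \<psi>) (snd p)))\<^sup>2)"
    unfolding DeltaA_inf_eq[OF A(1) \<psi>] by (intro sum_mono2) auto
  \<comment> \<open>The diagonal terms are nonnegative; adding them gives the full sums over rows
    and columns.\<close>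
  also have "\<dots> = (\<Sum>i<D. \<Sum>j<D. ?p i * ?p j * (cmod (mat_elem A i j))\<^sup>2)"
    by (simp add: sum.cartesian_product split_beta norm_mult power_mult_distrib mult_ac)
  also have "\<dots> \<le> M\<^sup>2 * (\<Sum>j<D. (?p j)\<^sup>2)"
    by (rule sum_mat_elem_weighted_le[OF A])
  finally show ?thesis by (simp flip: power_mult)
qed

end

text \<open>The gap condition makes the D roots of the characteristic polynomial distinct. One
  eigenvector for each root therefore gives D vectors, which are orthogonal because H is Hermitian,
  and normalising them yields the basis.\<close>

lemma exists_nondegenerate_energy_eigenbasis:
  assumes H: "hermitian_mat D H" and gaps: "spectrum_nondeg_gaps H"
  shows "\<exists>u e. nondegenerate_energy_eigenbasis D u H e"
proof -
  have Hc: "H \<in> carrier_mat D D" using H by (simp add: hermitian_mat_def)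
  obtain E where cp: "char_poly H = (\<Prod>a\<leftarrow>E. [:- a, 1:])" and nd: "nondeg_gaps E"
    using gaps by (auto simp: spectrum_nondeg_gaps_def)
  have len: "length E = D"
    using degree_monic_char_poly[OF Hc] by (simp add: cp degree_linear_factors)
  have ndD: "i = i' \<and> j = j'" if "i < D" "j < D" "i' < D" "j' < D" "i \<noteq> j" "E ! i - E ! j = E ! i' - E ! j'" for i j i' j'
    using nd that unfolding nondeg_gaps_def len by blast
  have dist: "E ! i \<noteq> E ! j" if "i < D" "j < D" "i \<noteq> j" for i j
    using ndD[of i j j i] that by auto
  have "\<exists>v. eigenvector H v (E ! j)" if "j < D" for j
  proof -
    have "poly (char_poly H) (E ! j) = 0"
      using that len unfolding cp poly_prod_list by (auto simp: prod_list_zero_iff intro!: bexI[of _ "E ! j"])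
    then show ?thesis using eigenvalue_root_char_poly[OF Hc] by (simp add: eigenvalue_def)
  qed
  then obtain v where v: "\<And>j. j < D \<Longrightarrow> eigenvector H (v j) (E ! j)" by metis
  have vc: "v j \<in> carrier_vec D" "v j \<noteq> 0\<^sub>v D" "H *\<^sub>v v j = E ! j \<cdot>\<^sub>v v j" if "j < D" for j
    using v[OF that] Hc by (auto simp: eigenvector_def)
  have ev: "(\<Sum>k<D. H $$ (i,k) * v j $ k) = E ! j * v j $ i" if "j < D" "i < D" for i j
    using vc[OF that(1)] that mult_mat_vec_index_sum[OF Hc vc(1)[OF that(1)] that(2)] by simp
  define ip where "ip i j = (\<Sum>k<D. cnj (v i $ k) * v j $ k)" for i j
  \<comment> \<open>Moving H across the inner product. The case i = j makes the eigenvalues real;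
    distinct real eigenvalues then make the eigenvectors orthogonal.\<close>
  have ip: "cnj (E ! i) * ip i j = E ! j * ip i j" if "i < D" "j < D" for i j
  proof -
    have "cnj (E ! i) * ip i j = (\<Sum>k<D. cnj (E ! i * v i $ k) * v j $ k)"
      by (simp add: ip_def sum_distrib_left mult.assoc)
    also have "\<dots> = (\<Sum>k<D. cnj (\<Sum>l<D. H $$ (k,l) * v i $ l) * v j $ k)"
      using that by (simp add: ev)
    also have "\<dots> = (\<Sum>k<D. \<Sum>l<D. cnj (v i $ l) * (H $$ (l,k) * v j $ k))"
      unfolding cnj_sum sum_distrib_right by (intro sum.cong) (auto simp: hermitian_mat_cnj_entry[OF H] mult_ac)
    also have "\<dots> = (\<Sum>l<D. cnj (v i $ l) * (\<Sum>k<D. H $$ (l,k) * v j $ k))"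
      unfolding sum_distrib_left by (rule sum.swap)
    also have "\<dots> = (\<Sum>l<D. E ! j * (cnj (v i $ l) * v j $ l))"
      using that by (intro sum.cong) (simp_all add: ev)
    also have "\<dots> = E ! j * ip i j"
      by (simp add: ip_def sum_distrib_left)
    finally show ?thesis .
  qed
  define r where "r j = sqrt (\<Sum>k<D. (cmod (v j $ k))\<^sup>2)" for j
  have ipr: "ip j j = complex_of_real ((r j)\<^sup>2)" for j
  proof -
    have "(r j)\<^sup>2 = (\<Sum>k<D. (cmod (v j $ k))\<^sup>2)" by (simp add: r_def sum_nonneg)
    then show ?thesis by (simp add: ip_def complex_norm_square mult.commute del: of_real_power)
  qed
  have r0: "r j \<noteq> 0" if "j < D" for j
  proof
    assume "r j = 0"
    then have "\<forall>k<D. v j $ k = 0" by (simp add: r_def sum_nonneg_eq_0_iff)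
    then have "v j = 0\<^sub>v D" using vc(1)[OF that] by (intro eq_vecI) auto
    then show False using vc(2)[OF that] by simp
  qed
  define e where "e j = Re (E ! j)" for j
  have real: "E ! j = complex_of_real (e j)" if "j < D" for j
  proof -
    have "cnj (E ! j) = E ! j" using ip[OF that that] r0[OF that] by (simp add: ipr)
    then show ?thesis by (simp add: e_def complex_eq_iff)
  qed
  have ip0: "ip i j = 0" if "i < D" "j < D" "i \<noteq> j" for i j
    using ip[OF that(1,2)] dist[OF that] real[OF that(1)] by auto
  define u where "u j k = v j $ k / r j" for j k
  have "nondegenerate_energy_eigenbasis D u H e"
  proof
    fix i j assume ij: "i < D" "j < D"
    have "(\<Sum>k<D. cnj (u i k) * u j k) = ip i j / (r i * r j)"
      by (simp add: u_def ip_def sum_divide_distrib)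
    also have "\<dots> = (if i = j then 1 else 0)"
      using ip0[OF ij] ipr[of i] r0[OF ij(1)] by (auto simp: power2_eq_square)
    finally show "(\<Sum>k<D. cnj (u i k) * u j k) = (if i = j then 1 else 0)" .
  next
    show "hermitian_mat D H" by fact
  next
    fix i j assume ij: "j < D" "i < D"
    then show "(\<Sum>k<D. H $$ (i,k) * u j k) = e j * u j i"
      using ev[OF ij] real[OF ij(1)] by (simp add: u_def flip: sum_divide_distrib)
  next
    show "inj_on (\<lambda>p. e (fst p) - e (snd p)) {p\<in>{..<D} \<times> {..<D}. fst p \<noteq> snd p}"
    proof (rule inj_onI)
      fix p q assume pq: "p \<in> {p\<in>{..<D} \<times> {..<D}. fst p \<noteq> snd p}" "q \<in> {p\<in>{..<D} \<times> {..<D}. fst p \<noteq> snd p}"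
        and eq: "e (fst p) - e (snd p) = e (fst q) - e (snd q)"
      have "E ! fst p - E ! snd p = E ! fst q - E ! snd q"
        using pq arg_cong[OF eq, of complex_of_real] by (auto simp: real)
      then show "p = q" using ndD[of "fst p" "snd p" "fst q" "snd q"] pq by (auto simp: prod_eq_iff)
    qed
  qed
  then show ?thesis by blast
qed

subsection \<open>Concentration\<close>

text \<open>Markov's inequality at threshold \<epsilon>. X carries the integral bound, while Y is
  the quantity of interest.\<close>

lemma measure_ge_of_nn_integral_le:
  fixes X :: "'a \<Rightarrow> real"
  assumes "prob_space P" and X: "X \<in> borel_measurable P"
    and Y: "Y \<in> borel_measurable P" and le: "\<And>x. x \<in> space P \<Longrightarrow> Y x \<le> X x"
    and int: "(\<integral>\<^sup>+x. ennreal (X x) \<partial>P) \<le> ennreal (\<delta> * \<epsilon>)" and \<epsilon>: "0 < \<epsilon>" and \<delta>: "0 \<le> \<delta>"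
  shows "1 - \<delta> \<le> measure P {x \<in> space P. Y x \<le> \<epsilon>}"
proof -
  interpret prob_space P by fact
  let ?B = "{x \<in> space P. \<epsilon> < Y x}"
  have B: "?B \<in> sets P" using Y by measurable
  have "ennreal \<epsilon> * emeasure P ?B = (\<integral>\<^sup>+x. ennreal \<epsilon> * indicator ?B x \<partial>P)"
    using B by (simp add: nn_integral_cmult)
  also have "\<dots> \<le> (\<integral>\<^sup>+x. ennreal (X x) \<partial>P)"
    using le by (intro nn_integral_mono) (force simp: indicator_def intro!: ennreal_leI)
  also have "\<dots> \<le> ennreal (\<delta> * \<epsilon>)" by (rule int)
  finally have "ennreal (\<epsilon> * measure P ?B) \<le> ennreal (\<delta> * \<epsilon>)"
    using \<epsilon> by (simp add: emeasure_eq_measure ennreal_mult)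
  then have "measure P ?B \<le> \<delta>" using \<epsilon> \<delta> by (simp add: mult.commute)
  moreover have "{x \<in> space P. Y x \<le> \<epsilon>} = space P - ?B" by auto
  ultimately show ?thesis using prob_compl[OF B] by simp
qed

context nondegenerate_energy_eigenbasis
begin

lemma coeff_product_state:
  assumes "D = d ^ n"
  shows "coeff (($) (product_state d n \<phi>)) j
      = (\<Sum>k<d ^ n. cnj (u j k) * (\<Prod>l<n. \<phi> l (k div d ^ l mod d)))"
  unfolding coeff_def product_state_def by (simp add: assms)

lemma borel_measurable_coeff_product_state:
  assumes "haar_sphere d \<mu>" "0 < d" "D = d ^ n"
  shows "(\<lambda>\<phi>. coeff (($) (product_state d n \<phi>)) j) \<in> borel_measurable (product_measure n \<mu>)"
  unfolding coeff_product_state[OF assms(3)]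
  by (rule borel_measurable_product_amplitude[OF assms(2) borel_measurable_haar_coord[OF assms(1)]])

text \<open>The amplitudes on different levels are dependent, but only the expectation of a sum is
  taken, so each unit eigenvector can be treated separately.\<close>

lemma product_state_fourth_moment:
  assumes h: "haar_sphere d \<mu>" and d: "2 \<le> d" and D: "D = d ^ n"
  shows "(\<integral>\<^sup>+\<phi>. ennreal (\<Sum>j<D. cmod (coeff (($) (product_state d n \<phi>)) j) ^ 4) \<partial>product_measure n \<mu>)
     \<le> ennreal ((2 / (real d + 1)) ^ n)"
proof -
  define K where "K = 2 / (real d * (real d + 1))"
  have K0: "0 \<le> K" by (simp add: K_def)
  have pr: "prob_space \<mu>" using h by (simp add: haar_sphere_def)
  have d0: "0 < d" using d by simp
  have mom: "(\<integral>\<^sup>+\<phi>. ennreal (cmod (\<Sum>i<d. v i * \<phi> i) ^ 4) \<partial>\<mu>) \<le> ennreal (K * (\<Sum>i<d. (cmod (v i))\<^sup>2)\<^sup>2)" for v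
    by (simp add: nn_integral_eq_integral[OF integrable_haar_linear_power[OF h]] haar_fourth_moment[OF h d] K_def)
  have "(\<integral>\<^sup>+\<phi>. ennreal (\<Sum>j<D. cmod (coeff (($) (product_state d n \<phi>)) j) ^ 4) \<partial>product_measure n \<mu>)
     = (\<integral>\<^sup>+\<phi>. (\<Sum>j<D. ennreal (cmod (coeff (($) (product_state d n \<phi>)) j) ^ 4)) \<partial>product_measure n \<mu>)"
    by simp
  also have "\<dots> = (\<Sum>j<D. \<integral>\<^sup>+\<phi>. ennreal (cmod (coeff (($) (product_state d n \<phi>)) j) ^ 4) \<partial>product_measure n \<mu>)"
    by (intro nn_integral_sum measurable_compose[OF _ measurable_ennreal] borel_measurable_power
        measurable_compose[OF _ borel_measurable_norm]
        borel_measurable_coeff_product_state[OF h d0 D])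
  also have "\<dots> \<le> (\<Sum>j<D. ennreal (K ^ n))"
  proof (intro sum_mono)
    fix j assume j: "j \<in> {..<D}"
    have "(\<Sum>k<d ^ n. (cmod (cnj (u j k)))\<^sup>2) = 1" using norm_square_basis[of j] j by (simp add: D)
    then show "(\<integral>\<^sup>+\<phi>. ennreal (cmod (coeff (($) (product_state d n \<phi>)) j) ^ 4) \<partial>product_measure n \<mu>) \<le> ennreal (K ^ n)"
      using product_fourth_moment[OF pr d0 K0 borel_measurable_haar_coord[OF h] mom, where v = "\<lambda>k. cnj (u j k)" and n = n]
      unfolding coeff_product_state[OF D] by simp
  qed
  also have "\<dots> = ennreal (real (d ^ n) * K ^ n)"
    by (simp add: D K0 ennreal_mult ennreal_of_nat_eq_real_of_nat del: of_nat_power)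
  also have "real (d ^ n) * K ^ n = (2 / (real d + 1)) ^ n"
    using d by (simp add: K_def flip: power_mult_distrib)
  finally show "(\<integral>\<^sup>+\<phi>. ennreal (\<Sum>j<D. cmod (coeff (($) (product_state d n \<phi>)) j) ^ 4) \<partial>product_measure n \<mu>)
     \<le> ennreal ((2 / (real d + 1)) ^ n)" .
qed

lemma measure_DeltaA_inf_le:
  assumes h: "haar_sphere d \<mu>" and d: "2 \<le> d" and D: "D = d ^ n"
    and A: "A \<in> carrier_mat D D" "op_norm D A \<le> M"
    and \<epsilon>: "0 < \<epsilon>" and \<delta>: "M\<^sup>2 * (2 / (real d + 1)) ^ n \<le> \<delta> * \<epsilon>"
  shows "1 - \<delta> \<le> measure (product_measure n \<mu>)
    {\<phi> \<in> space (product_measure n \<mu>). DeltaA_inf H A (product_state d n \<phi>) \<le> \<epsilon>}"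
proof (rule measure_ge_of_nn_integral_le)
  let ?X = "\<lambda>\<phi>. M\<^sup>2 * (\<Sum>j<D. cmod (coeff (($) (product_state d n \<phi>)) j) ^ 4)"
  have "0 < d" using d by simp
  note meas[measurable] = borel_measurable_coeff_product_state[OF h this D]
  have \<psi>: "product_state d n \<phi> \<in> carrier_vec D" for \<phi> by (simp add: product_state_def D)
  show "prob_space (product_measure n \<mu>)"
    unfolding product_measure_def using h by (intro prob_space_PiM) (simp add: haar_sphere_def)
  show "?X \<in> borel_measurable (product_measure n \<mu>)" by measurable
  \<comment> \<open>\<open>measure\<close> is 0 on non-measurable sets, so the event must be shown
    measurable. The closed formula expresses the time average as a polynomial in the moduli of
    finitely many measurable amplitudes.\<close>
  show "(\<lambda>\<phi>. DeltaA_inf H A (product_state d n \<phi>)) \<in> borel_measurable (product_measure n \<mu>)"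
    unfolding DeltaA_inf_eq[OF A(1) \<psi>] norm_mult complex_mod_cnj
    by (intro borel_measurable_sum borel_measurable_power borel_measurable_times
        measurable_compose[OF _ borel_measurable_norm] meas borel_measurable_const)
  show "DeltaA_inf H A (product_state d n \<phi>) \<le> ?X \<phi>" for \<phi>
    by (rule DeltaA_inf_le[OF A \<psi>])
  have "(\<integral>\<^sup>+\<phi>. ennreal (?X \<phi>) \<partial>product_measure n \<mu>)
      = (\<integral>\<^sup>+\<phi>. ennreal (M\<^sup>2) * ennreal (\<Sum>j<D. cmod (coeff (($) (product_state d n \<phi>)) j) ^ 4) \<partial>product_measure n \<mu>)"
    by (intro nn_integral_cong ennreal_mult) (simp_all add: sum_nonneg)
  also have "\<dots> = ennreal (M\<^sup>2) * (\<integral>\<^sup>+\<phi>. ennreal (\<Sum>j<D. cmod (coeff (($) (product_state d n \<phi>)) j) ^ 4) \<partial>product_measure n \<mu>)"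
    by (intro nn_integral_cmult) measurable
  also have "\<dots> \<le> ennreal (M\<^sup>2) * ennreal ((2 / (real d + 1)) ^ n)"
    by (intro mult_left_mono product_state_fourth_moment[OF h d D]) simp
  also have "\<dots> \<le> ennreal (\<delta> * \<epsilon>)"
    using \<delta> by (simp add: ennreal_leI flip: ennreal_mult)
  finally show "(\<integral>\<^sup>+\<phi>. ennreal (?X \<phi>) \<partial>product_measure n \<mu>) \<le> ennreal (\<delta> * \<epsilon>)" .
  have "0 \<le> M\<^sup>2 * (2 / (real d + 1)) ^ n" by simp
  then have "0 \<le> \<delta> * \<epsilon>" using \<delta> by linarith
  then show "0 \<le> \<delta>" using \<epsilon> by (simp add: zero_le_mult_iff)
qed (rule \<epsilon>)

end

theorem theorem4:
  fixes d :: nat and M :: real and \<mu> :: "(nat \<Rightarrow> complex) measure"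
  assumes "d \<ge> 2" and "M > 0" and "haar_sphere d \<mu>"
  shows "\<exists>c>0. \<exists>N. \<forall>n\<ge>N. \<forall>H A.
           hermitian_mat (d ^ n) H \<longrightarrow> spectrum_nondeg_gaps H \<longrightarrow>
           A \<in> carrier_mat (d ^ n) (d ^ n) \<longrightarrow> op_norm (d ^ n) A \<le> M \<longrightarrow>
           measure (product_measure n \<mu>)
             {\<phi> \<in> space (product_measure n \<mu>).
                DeltaA_inf H A (product_state d n \<phi>) \<le> exp (- c * real n)}
           \<ge> 1 - exp (- c * real n)"
proof -
  \<comment> \<open>For d >= 2 the ratio 2 / (d + 1) is at most 2/3 = 5/6 * 4/5. The factor (4/5)^n
    = exp (-2 c n) is shared equally by the threshold and the failure probability, and (5/6)^n is
    reserved to absorb M^2. Thus c is absolute, and M enters only through N.\<close>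
  define c :: real where "c = ln (5 / 4) / 2"
  have c: "0 < c" by (simp add: c_def)
  have exp_c: "exp (- c * real n) * exp (- c * real n) = (4 / 5) ^ n" for n
  proof -
    have "exp (- c * real n) * exp (- c * real n) = exp (real n * (- ln (5 / 4)))"
      by (simp add: c_def flip: exp_add)
    also have "\<dots> = exp (- ln (5 / 4)) ^ n" by (rule exp_of_nat_mult)
    also have "exp (- ln (5 / 4)) = 4 / (5 :: real)" by (simp add: exp_minus)
    finally show ?thesis .
  qed
  have "(\<lambda>n. M\<^sup>2 * (5 / 6) ^ n) \<longlonglongrightarrow> 0"
    by (intro tendsto_mult_right_zero LIMSEQ_power_zero) simp
  then have "\<forall>\<^sub>F n in sequentially. M\<^sup>2 * (5 / 6) ^ n < 1"
    by (rule order_tendstoD) simp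
  then obtain N where N: "\<And>n. n \<ge> N \<Longrightarrow> M\<^sup>2 * (5 / 6) ^ n < 1"
    by (auto simp: eventually_sequentially)
  have bound: "M\<^sup>2 * (2 / (real d + 1)) ^ n \<le> exp (- c * real n) * exp (- c * real n)" if "N \<le> n" for n
  proof -
    have "2 / (real d + 1) \<le> 2 / 3"
      using assms(1) by (intro divide_left_mono) auto
    then have "M\<^sup>2 * (2 / (real d + 1)) ^ n \<le> M\<^sup>2 * (2 / 3) ^ n"
      by (intro mult_left_mono power_mono) auto
    also have "(2 / 3 :: real) ^ n = (5 / 6) ^ n * (4 / 5) ^ n"
      by (simp flip: power_mult_distrib)
    also have "M\<^sup>2 * ((5 / 6) ^ n * (4 / 5) ^ n) \<le> 1 * (4 / 5) ^ n"
      using N[OF that] unfolding mult.assoc[symmetric] by (intro mult_right_mono) auto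
    finally show ?thesis by (simp only: exp_c mult_1)
  qed
  show ?thesis
  proof (intro exI[of _ c] exI[of _ N] conjI c allI impI)
    fix n H A
    assume n: "N \<le> n" and H: "hermitian_mat (d ^ n) H" "spectrum_nondeg_gaps H"
      and A: "A \<in> carrier_mat (d ^ n) (d ^ n)" "op_norm (d ^ n) A \<le> M"
    obtain u e where "nondegenerate_energy_eigenbasis (d ^ n) u H e"
      using exists_nondegenerate_energy_eigenbasis[OF H] by blast
    then interpret nondegenerate_energy_eigenbasis "d ^ n" u H e .
    show "measure (product_measure n \<mu>)
             {\<phi> \<in> space (product_measure n \<mu>).
                DeltaA_inf H A (product_state d n \<phi>) \<le> exp (- c * real n)}
           \<ge> 1 - exp (- c * real n)"
      by (rule measure_DeltaA_inf_le[OF assms(3,1) refl A _ bound[OF n]]) simp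
  qed
qed

end
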